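(* Let $M$ be a regular quad mesh in $\mathbb{R}^3$ with vertices $v_{ij}$ and vertex weights $w_{ij}>0$, such that every face $f$ has a well-defined contact element $(b_f,\pm\mathbf{n}_f)$, and let $\hat v_{ij}=(w_{ij}v_{ij},w_{ij})\in\mathbb{R}^4$ be the homogeneous coordinate vectors of the weighted vertices. Apply Doo-Sabin refinement to the vectors $\hat v_{ij}$. Then: (1) Doo-Sabin refinement interpolates contact elements: for every face $f$ of $M$, the refined face $f'$ associated with $f$ has the same contact element as $f$, i.e. $b_{f'}=b_f$ and $\mathbf{n}_{f'}=\pm\mathbf{n}_f$ (with the same plane $\tau_{f'}=\tau_f$). (2) In the limit, repeated Doo-Sabin refinement produces a $C^1$-smooth rational biquadratic spline surface whose spline control points are the weighted vertices of $M$; that is, the refined nets converge to $\hat S$, and the limit surface is $s$, where $\hat S$ and $s$ are as defined in the context, and $s$ is $C^1$. (3) This spline surface interpolates the contact elements of $M$: for every face $f$ of $M$ the surface $s$ passes through $b_f$ (at the parameter value corresponding to the center of $f$), and its tangent plane there is $\tau_f$, with unit normal $\pm\mathbf{n}_f$.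
   Context: Regular quad mesh: vertices $v_{ij}\in\mathbb{R}^3$ are indexed by $(i,j)\in I\times J$, where $I,J$ are (finite or infinite) intervals of consecutive integers with at least three elements each; the faces are the quadrilaterals with vertices $v_{ij},v_{i+1,j},v_{i+1,j+1},v_{i,j+1}$. Faces need not be planar. Homogeneous coordinates: a point $v\in\mathbb{R}^3$ with weight $w>0$ is represented by $\hat v=(wv,w)\in\mathbb{R}^4$; conversely $(x_1,x_2,x_3,\lambda)$ with $\lambda\neq0$ represents the point $(x_1/\lambda,x_2/\lambda,x_3/\lambda)$ with weight $\lambda$. Contact element of a face: let $f$ have cyclically ordered vertices $v_0,v_1,v_2,v_3$ with weights $w_0,\dots,w_3>0$. The edge points are $m_{e_k}=\frac{w_kv_k+w_{k+1}v_{k+1}}{w_k+w_{k+1}}$ (indices mod 4); they are always coplanar. The contact element is well defined if the edge points are not collinear; then $\tau_f$ is the plane containing the four edge points, $\mathbf{n}_f$ is a unit normal vector of $\tau_f$, and $b_f=\frac{w_0v_0+w_1v_1+w_2v_2+w_3v_3}{w_0+w_1+w_2+w_3}$ is the contact point, with homogeneous coordinate vector $\hat b_f=\frac14(\hat v_0+\hat v_1+\hat v_2+\hat v_3)$. Unit normals are considered up to the choice of a consistent orientation, indicated here by $\pm$. Doo-Sabin refinement: for each face $f$ with vertices $\hat v_0,\hat v_1,\hat v_2,\hat v_3$ (cyclically ordered) and each of its vertices $\hat v_k$, one constructs a new vertex $$\hat v_{k,f}'=\tfrac1{16}\bigl(9\hat v_k+3\hat v_{k+1}+3\hat v_{k-1}+\hat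 v_{k+2}\bigr)\quad(\text{indices mod }4).$$ Each face $f$, each interior edge and each interior vertex of the original mesh gives rise to a cycle of new vertices forming a new face; the new face associated with $f$ is $f'=(\hat v_{0,f}',\hat v_{1,f}',\hat v_{2,f}',\hat v_{3,f}')$. The refined mesh is again a regular quad mesh, whose points and weights are read off from the vectors in $\mathbb{R}^4$. Limit surface: place $\hat v_{ij}$ at parameter value $(i,j)$, and in each refinement step place the new vertex belonging to a vertex and a face at the parameter value obtained by applying the same rule $\tfrac1{16}(9,3,3,1)$ to the parameter values. Let $N:\mathbb{R}\to\mathbb{R}$ be the uniform quadratic B-spline with support $[-\tfrac32,\tfrac32]$ and integer-spaced knots at $\mathbb{Z}+\tfrac12$ (normalized so that $\sum_{i\in\mathbb{Z}}N(u-i)=1$). Set $$\hat S(u,v)=\sum_{i\in I,\,j\in J}N(u-i)N(v-j)\,\hat v_{ij},$$ for $(u,v)\in[\inf I+\tfrac12,\sup I-\tfrac12]\times[\inf J+\tfrac12,\sup J-\tfrac12]$ (with unbounded intervals if $I$ or $J$ is unbounded), and let $s(u,v)\in\mathbb{R}^3$ be the point with homogeneous coordinates $\hat S(u,v)$. "The refined nets converge to $\hat S$" means that the piecewise bilinear interpolants of the $k$-times refined nets converge to $\hat S$ locally uniformly on this parameter domain as $k\to\infty$. The center of the face with vertices $v_{ij},v_{i+1,j},v_{i+1,j+1},v_{i,j+1}$ corresponds to the parameter value $(i+\tfrac12,j+\tfrac12)$. *)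

theory Defs
  imports "HOL-Analysis.Analysis"
begin

text \<open>
  A net assigns a value to every pair of integers; only the values on \<open>I \<times> J\<close> matter.
\<close>

definition index_interval :: "int set \<Rightarrow> bool" where
  "index_interval I \<longleftrightarrow>
     (\<forall>a\<in>I. \<forall>b\<in>I. {a..b} \<subseteq> I) \<and> (infinite I \<or> 3 \<le> card I)"

text \<open>A face is named by its corner with the smallest indices.\<close>

definition faces :: "int set \<Rightarrow> int set \<Rightarrow> (int \<times> int) set" where
  "faces I J = {(i, j). i \<in> I \<and> i + 1 \<in> I \<and> j \<in> J \<and> j + 1 \<in> J}"

text \<open>
  The four corners of a face in cyclic order.  The index type \<open>4\<close> carries arithmetic modulo 4.
\<close>

definition face :: "(int \<Rightarrow> int \<Rightarrow> 'a) \<Rightarrow> int \<Rightarrow> int \<Rightarrow> 4 \<Rightarrow> 'a" where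
  "face V i j k =
     (if k = 0 then V i j
      else if k = 1 then V (i + 1) j
      else if k = 2 then V (i + 1) (j + 1)
      else V i (j + 1))"

text \<open>\<open>\<real>\<^sup>4\<close> is rendered as \<open>\<real>\<^sup>3 \<times> \<real>\<close>, the last coordinate being the weight.\<close>

type_synonym hvec = "(real ^ 3) \<times> real"

definition homog :: "(int \<Rightarrow> int \<Rightarrow> real ^ 3) \<Rightarrow> (int \<Rightarrow> int \<Rightarrow> real) \<Rightarrow> int \<Rightarrow> int \<Rightarrow> hvec" where
  "homog v w i j = (w i j *\<^sub>R v i j, w i j)"

abbreviation weight :: "hvec \<Rightarrow> real" where
  "weight x \<equiv> snd x"

definition point :: "hvec \<Rightarrow> real ^ 3" where
  "point x = fst x /\<^sub>R weight x"

definition edge_point :: "(4 \<Rightarrow> hvec) \<Rightarrow> 4 \<Rightarrow> real ^ 3" where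
  "edge_point q k =
     (weight (q k) *\<^sub>R point (q k) + weight (q (k + 1)) *\<^sub>R point (q (k + 1)))
       /\<^sub>R (weight (q k) + weight (q (k + 1)))"

definition has_contact_element :: "(4 \<Rightarrow> hvec) \<Rightarrow> bool" where
  "has_contact_element q \<longleftrightarrow> (\<forall>k. 0 < weight (q k)) \<and> \<not> collinear (range (edge_point q))"

definition contact_point :: "(4 \<Rightarrow> hvec) \<Rightarrow> real ^ 3" where
  "contact_point q = (\<Sum>k\<in>UNIV. weight (q k) *\<^sub>R point (q k)) /\<^sub>R (\<Sum>k\<in>UNIV. weight (q k))"

definition contact_plane :: "(4 \<Rightarrow> hvec) \<Rightarrow> (real ^ 3) set" where
  "contact_plane q = (THE T. affine T \<and> aff_dim T = 2 \<and> range (edge_point q) \<subseteq> T)"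

definition unit_normal :: "(real ^ 3) set \<Rightarrow> real ^ 3 \<Rightarrow> bool" where
  "unit_normal T n \<longleftrightarrow> norm n = 1 \<and> (\<forall>x\<in>T. \<forall>y\<in>T. n \<bullet> (x - y) = 0)"

definition refined_face :: "(4 \<Rightarrow> 'a::real_vector) \<Rightarrow> 4 \<Rightarrow> 'a" where
  "refined_face q k =
     (1 / 16) *\<^sub>R (9 *\<^sub>R q k + 3 *\<^sub>R q (k + 1) + 3 *\<^sub>R q (k - 1) + q (k + 2))"

text \<open>
  The new vertex belonging to the face \<open>(i, j)\<close> and its corner \<open>(i + a, j + b)\<close>, with
  \<open>a, b \<in> {0, 1}\<close>, gets the index \<open>(2 * i + a, 2 * j + b)\<close>.  Two consecutive new indices
  \<open>2 * i + 1\<close> and \<open>2 * i + 2\<close> thus belong to the same old index \<open>i + 1\<close>, seen from the two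
  faces adjacent to it; so the faces of the refined net with indices (even, even) come from the
  old faces, those with exactly one odd index from the interior edges, and those with indices
  (odd, odd) from the interior vertices.
\<close>

definition refine :: "(int \<Rightarrow> int \<Rightarrow> 'a::real_vector) \<Rightarrow> int \<Rightarrow> int \<Rightarrow> 'a" where
  "refine V m n =
     refined_face (face V (m div 2) (n div 2))
       (if even m then (if even n then 0 else 3) else (if even n then 1 else 2))"

definition refine_index :: "int set \<Rightarrow> int set" where
  "refine_index I = {m. m div 2 \<in> I \<and> m div 2 + 1 \<in> I}"

lemma face_refine: "face (refine V) (2 * i) (2 * j) = refined_face (face V i j)"
proof
  fix k :: 4
  show "face (refine V) (2 * i) (2 * j) k = refined_face (face V i j) k"
    using exhaust_4[of k] by (auto simp: face_def[of "refine V"] refine_def)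
qed

definition bilinear_patch :: "(4 \<Rightarrow> 'a::real_vector) \<Rightarrow> real \<Rightarrow> real \<Rightarrow> 'a" where
  "bilinear_patch q a b =
     ((1 - a) * (1 - b)) *\<^sub>R q 0 + (a * (1 - b)) *\<^sub>R q 1 + (a * b) *\<^sub>R q 2 + ((1 - a) * b) *\<^sub>R q 3"

text \<open>The interpolant of the net \<open>V\<close> whose vertices are placed at the parameter values \<open>P\<close>.\<close>

definition bilinear_interpolant ::
  "int set \<Rightarrow> int set \<Rightarrow> (int \<Rightarrow> int \<Rightarrow> real \<times> real) \<Rightarrow> (int \<Rightarrow> int \<Rightarrow> 'a::real_vector)
     \<Rightarrow> real \<times> real \<Rightarrow> 'a" where
  "bilinear_interpolant I J P V x =
     (THE z. \<exists>(m, n) \<in> faces I J. \<exists>a\<in>{0..1}. \<exists>b\<in>{0..1}.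
        x = bilinear_patch (face P m n) a b \<and> z = bilinear_patch (face V m n) a b)"

definition refined_interpolant ::
  "int set \<Rightarrow> int set \<Rightarrow> (int \<Rightarrow> int \<Rightarrow> 'a::real_vector) \<Rightarrow> nat \<Rightarrow> real \<times> real \<Rightarrow> 'a" where
  "refined_interpolant I J V k =
     bilinear_interpolant ((refine_index ^^ k) I) ((refine_index ^^ k) J)
       ((refine ^^ k) (\<lambda>i j. (real_of_int i, real_of_int j))) ((refine ^^ k) V)"

text \<open>Cox-de Boor recursion for the B-spline of degree \<open>d\<close> with knots \<open>t i, \<dots>, t (i + d + 1)\<close>.\<close>

fun bspline :: "(int \<Rightarrow> real) \<Rightarrow> nat \<Rightarrow> int \<Rightarrow> real \<Rightarrow> real" where
  "bspline t 0 i x = (if t i \<le> x \<and> x < t (i + 1) then 1 else 0)"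
| "bspline t (Suc d) i x =
     (x - t i) / (t (i + int d + 1) - t i) * bspline t d i x +
     (t (i + int d + 2) - x) / (t (i + int d + 2) - t (i + 1)) * bspline t d (i + 1) x"

definition N_spline :: "real \<Rightarrow> real" where
  "N_spline = bspline (\<lambda>k. real_of_int k + 1 / 2) 2 (- 2)"

lemma N_spline_explicit:
  "N_spline x = (if \<bar>x\<bar> \<le> 1 / 2 then 3 / 4 - x\<^sup>2
                 else if \<bar>x\<bar> \<le> 3 / 2 then (3 / 2 - \<bar>x\<bar>)\<^sup>2 / 2
                 else 0)"
proof (cases "x = 1 / 2")
  case True
  show ?thesis
    unfolding True by (simp add: N_spline_def numeral_2_eq_2 power2_eq_square)
next
  case False
  then consider "x < - 3 / 2" | "- 3 / 2 \<le> x" "x < - 1 / 2" | "- 1 / 2 \<le> x" "x < 1 / 2"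
    | "1 / 2 < x" "x < 3 / 2" | "3 / 2 \<le> x"
    by linarith
  then show ?thesis
    by cases (auto simp: N_spline_def numeral_2_eq_2 abs_if field_simps power2_eq_square)
qed

definition S_hat :: "int set \<Rightarrow> int set \<Rightarrow> (int \<Rightarrow> int \<Rightarrow> hvec) \<Rightarrow> real \<times> real \<Rightarrow> hvec" where
  "S_hat I J V = (\<lambda>(x, y). \<Sum>\<^sub>\<infinity>(i, j)\<in>I \<times> J.
     (N_spline (x - real_of_int i) * N_spline (y - real_of_int j)) *\<^sub>R V i j)"

definition surface :: "int set \<Rightarrow> int set \<Rightarrow> (int \<Rightarrow> int \<Rightarrow> hvec) \<Rightarrow> real \<times> real \<Rightarrow> real ^ 3" where
  "surface I J V x = point (S_hat I J V x)"

definition param_interval :: "int set \<Rightarrow> real set" where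
  "param_interval I =
     {u. (bdd_below I \<longrightarrow> real_of_int (Inf I) + 1 / 2 \<le> u) \<and>
         (bdd_above I \<longrightarrow> u \<le> real_of_int (Sup I) - 1 / 2)}"

definition param_domain :: "int set \<Rightarrow> int set \<Rightarrow> (real \<times> real) set" where
  "param_domain I J = param_interval I \<times> param_interval J"

definition face_center :: "int \<Rightarrow> int \<Rightarrow> real \<times> real" where
  "face_center i j = (real_of_int i + 1 / 2, real_of_int j + 1 / 2)"

definition locally_uniform_limit ::
  "'a::metric_space set \<Rightarrow> (nat \<Rightarrow> 'a \<Rightarrow> 'b::metric_space) \<Rightarrow> ('a \<Rightarrow> 'b) \<Rightarrow> bool" where
  "locally_uniform_limit D F f \<longleftrightarrow>
     (\<forall>x\<in>D. \<exists>e>0. uniform_limit (ball x e \<inter> D) F f sequentially)"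

text \<open>
  At boundary points of \<open>D\<close> derivatives are taken within \<open>D\<close>.  They are unique for the
  parameter domains above, which are products of nondegenerate intervals.
\<close>

definition C1_on ::
  "('a::real_normed_vector \<Rightarrow> 'b::real_normed_vector) \<Rightarrow> 'a set \<Rightarrow> bool" where
  "C1_on f D \<longleftrightarrow>
     (\<exists>f' :: 'a \<Rightarrow> 'a \<Rightarrow>\<^sub>L 'b.
        (\<forall>x\<in>D. (f has_derivative blinfun_apply (f' x)) (at x within D)) \<and> continuous_on D f')"

definition regular_at :: "(real \<times> real \<Rightarrow> real ^ 3) \<Rightarrow> (real \<times> real) set \<Rightarrow> real \<times> real \<Rightarrow> bool" where
  "regular_at s D c \<longleftrightarrow>
     s differentiable (at c within D) \<and> inj (frechet_derivative s (at c within D))"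

definition tangent_plane ::
  "(real \<times> real \<Rightarrow> real ^ 3) \<Rightarrow> (real \<times> real) set \<Rightarrow> real \<times> real \<Rightarrow> (real ^ 3) set" where
  "tangent_plane s D c = range (\<lambda>h. s c + frechet_derivative s (at c within D) h)"

end

(*
  Everything is a tensor product of the univariate Chaikin scheme.  After k steps the control
  values are exactly the polar form (blossom) of the quadratic spline at consecutive knots of
  spacing h = 2^-k.  This differs from the value of the spline by at most h^2, and the spline is
  Lipschitz, so the bilinear interpolants converge locally uniformly.

  For a face with homogeneous vertices q0, ..., q3 put s = q0 + q1 + q2 + q3,
  x = q1 + q2 - q0 - q3, y = q2 + q3 - q0 - q1.  The doubled edge sums are s + x, s - x, s + y,
  s - y, so the contact plane is spanned at the contact point s by the projections of the
  directions x and y.  Doo-Sabin refinement keeps s and halves x and y, hence keeps the contact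
  element.  At the face center the spline has value s/4 and partial derivatives x/2 and y/2,
  hence the same tangent plane.
*)
theory Submission
  imports Defs
begin

text \<open>Refinement acts on control coefficients, not on surface values, so iterating it calls
  for a closed form of the coefficients that obeys the refinement rule exactly at every level.
  Writing the B-spline as a third difference of truncated squares reduces this to the polar form of
  a single truncated square. Truncation is harmless there because its break point, an original knot,
  remains a knot at all finer levels. Meshes may be infinite or have a boundary, and net values off
  the mesh are arbitrary. Hence nets are extended by zero, and all sums are cut down to one finite
  window per unit ball. Smoothness is not inherited from the refined nets: it is read off the
  explicit sum, which is differentiable on the whole plane, so boundary points of the parameter
  domain need no one-sided argument. Weights do not disturb the geometry, because central projection
  moves the image of \<open>s + d\<close> exactly along the projected direction of \<open>d\<close>;
  weights only change lengths.\<close>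

section \<open>The quadratic B-spline and its blossom\<close>

text \<open>The polar form of the truncated square \<open>(max 0 y)\<^sup>2\<close>, evaluated at
  \<open>y - h / 2\<close> and \<open>y + h / 2\<close>; only meaningful if both lie on the same side of \<open>0\<close>.\<close>

definition trunc_square :: "real \<Rightarrow> real \<Rightarrow> real" where
  "trunc_square h y = (if h / 2 \<le> y then y\<^sup>2 - h\<^sup>2 / 4 else 0)"

text \<open>Half the third central difference of truncated squares is the classical formula for the
  quadratic B-spline; here each truncated square is replaced by its polar form.\<close>

definition spline_blossom :: "real \<Rightarrow> real \<Rightarrow> real" where
  "spline_blossom h x = (trunc_square h (x + 3/2) - 3 * trunc_square h (x + 1/2)
     + 3 * trunc_square h (x - 1/2) - trunc_square h (x - 3/2)) / 2"

lemma N_spline_eq_blossom: "N_spline x = spline_blossom 0 x"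
proof -
  consider "x < - 3 / 2" | "- 3 / 2 \<le> x" "x < - 1 / 2" | "- 1 / 2 \<le> x" "x \<le> 1 / 2"
    | "1 / 2 < x" "x < 3 / 2" | "3 / 2 \<le> x"
    by linarith
  then show ?thesis
    by cases (auto simp: N_spline_explicit spline_blossom_def trunc_square_def abs_if
        field_simps power2_eq_square)
qed

text \<open>On the left all four terms are truncated to 0; on the right none is, and the third
  difference of a quadratic vanishes. The radius 2 is the support radius 3/2 plus half the largest
  knot spacing 1.\<close>

lemma spline_blossom_eq_0:
  assumes "0 \<le> h" "h \<le> 1" "2 \<le> \<bar>x\<bar>"
  shows "spline_blossom h x = 0"
proof -
  consider "x \<le> -2" | "2 \<le> x" using assms by linarith
  then show ?thesis
    using assms by cases (auto simp: spline_blossom_def trunc_square_def field_simps power2_eq_square)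
qed

lemma trunc_square_error:
  assumes "0 \<le> h"
  shows "\<bar>trunc_square h y - trunc_square 0 y\<bar> \<le> h\<^sup>2 / 4"
proof -
  have "y\<^sup>2 \<le> h\<^sup>2 / 4" if "0 \<le> y" "y < h / 2"
    using power_mono[of y "h/2" 2] that by (simp add: power_divide)
  then show ?thesis using assms by (auto simp: trunc_square_def)
qed

text \<open>The coefficients 1, 3, 3, 1 add up to 8, so the error is at most 8/2 times the bound
  h^2/4 for one term.\<close>

lemma spline_blossom_error:
  assumes "0 \<le> h"
  shows "\<bar>spline_blossom h x - N_spline x\<bar> \<le> h\<^sup>2"
  unfolding N_spline_eq_blossom spline_blossom_def abs_le_iff
  using trunc_square_error[OF assms, of "x + 3/2"] trunc_square_error[OF assms, of "x + 1/2"]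
    trunc_square_error[OF assms, of "x - 1/2"] trunc_square_error[OF assms, of "x - 3/2"]
  unfolding abs_le_iff by (intro conjI; argo)

definition N_spline' :: "real \<Rightarrow> real" where
  "N_spline' x = max 0 (x + 3/2) - 3 * max 0 (x + 1/2) + 3 * max 0 (x - 1/2) - max 0 (x - 3/2)"

lemma trunc_square_has_real_derivative:
  "(trunc_square 0 has_real_derivative 2 * max 0 y) (at y)"
proof -
  consider "y < 0" | "y > 0" | "y = 0" by linarith
  then show ?thesis
  proof cases
    case 1
    have "((\<lambda>_. 0) has_real_derivative 2 * max 0 y) (at y)"
      using 1 by simp
    then show ?thesis
      by (rule has_field_derivative_transform_within_open[of _ _ _ "{..<0}"])
        (use 1 in \<open>auto simp: trunc_square_def\<close>)
  next
    case 2
    have "((\<lambda>y. y\<^sup>2) has_real_derivative 2 * max 0 y) (at y)"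
      using 2 by (auto intro!: derivative_eq_intros)
    then show ?thesis
      by (rule has_field_derivative_transform_within_open[of _ _ _ "{0<..}"])
        (use 2 in \<open>auto simp: trunc_square_def\<close>)
  next
    case 3
    \<comment> \<open>At the break point the difference quotient is \<open>max 0 h\<close>, which is
      squeezed by \<bar>h\<bar>.\<close>
    have "((\<lambda>h. \<bar>h::real\<bar>) \<longlongrightarrow> 0) (at 0)" by (auto intro!: tendsto_eq_intros)
    then have "((\<lambda>h. trunc_square 0 h / h) \<longlongrightarrow> 0) (at 0)"
      by (rule Lim_null_comparison[rotated])
        (auto simp: trunc_square_def power2_eq_square intro!: always_eventually)
    then show ?thesis using 3 by (simp add: DERIV_def trunc_square_def)
  qed
qed

lemma N_spline_has_real_derivative: "(N_spline has_real_derivative N_spline' x) (at x)"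
proof -
  have *: "((\<lambda>x. trunc_square 0 (x + c)) has_real_derivative 2 * max 0 (x + c)) (at x)" for c
    using trunc_square_has_real_derivative[of "x + c"] by (simp add: DERIV_shift)
  have "(spline_blossom 0 has_real_derivative N_spline' x) (at x)"
    unfolding spline_blossom_def[abs_def] N_spline'_def
    by (rule derivative_eq_intros *[of "3/2"] *[of "1/2"] *[of "-1/2", simplified]
        *[of "-3/2", simplified] refl | simp)+
  then show ?thesis by (simp add: N_spline_eq_blossom[abs_def])
qed

lemma continuous_on_N_spline [continuous_intros]:
  "continuous_on A f \<Longrightarrow> continuous_on A (\<lambda>x. N_spline (f x))"
  using continuous_on_compose2[of UNIV N_spline A f]
    DERIV_continuous_on[of UNIV N_spline N_spline'] N_spline_has_real_derivative by auto

lemma continuous_on_N_spline' [continuous_intros]: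
  "continuous_on A f \<Longrightarrow> continuous_on A (\<lambda>x. N_spline' (f x))"
  unfolding N_spline'_def by (intro continuous_intros)

lemma abs_N_spline'_le: "\<bar>N_spline' x\<bar> \<le> 1"
  by (auto simp: N_spline'_def max_def)

lemma N_spline_lipschitz: "\<bar>N_spline x - N_spline y\<bar> \<le> \<bar>x - y\<bar>"
  using field_differentiable_bound[of UNIV N_spline N_spline' 1 x y] abs_N_spline'_le
    N_spline_has_real_derivative by auto

lemma N_spline_nonneg: "0 \<le> N_spline x"
  by (auto simp: N_spline_explicit abs_le_square_iff power2_eq_square)
    (use abs_le_square_iff[of x "1/2"] in \<open>auto simp: power2_eq_square\<close>)

lemma N_spline_pos: "\<bar>x\<bar> \<le> 1/2 \<Longrightarrow> 0 < N_spline x"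
  using abs_le_square_iff[of x "1/2"] by (auto simp: N_spline_explicit power2_eq_square)

lemma N_spline_le_1: "N_spline x \<le> 1"
proof -
  have "(3/2 - \<bar>x\<bar>)\<^sup>2 \<le> 1\<^sup>2" if "1/2 < \<bar>x\<bar>" "\<bar>x\<bar> \<le> 3/2"
    using that by (intro power_mono) auto
  moreover have "3/4 - x\<^sup>2 \<le> 1" using zero_le_power2[of x] by linarith
  ultimately show ?thesis by (auto simp: N_spline_explicit)
qed

lemma N_spline_eq_0: "2 \<le> \<bar>x\<bar> \<Longrightarrow> N_spline x = 0"
  by (simp add: N_spline_eq_blossom spline_blossom_eq_0)

text \<open>After \<open>k\<close> steps the basis function of the control point \<open>i\<close> has the coefficient
  \<open>refined_coeff k m i\<close> at the index \<open>m\<close>: the polar form of its spline at the two knots of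
  spacing \<open>1 / 2 ^ k\<close> that enclose the parameter \<open>refined_param k m\<close>.\<close>

definition refined_param :: "nat \<Rightarrow> int \<Rightarrow> real" where
  "refined_param k m = (real_of_int m - 1/2) / 2 ^ k + 1/2"

definition refined_coeff :: "nat \<Rightarrow> int \<Rightarrow> int \<Rightarrow> real" where
  "refined_coeff k m i = spline_blossom (1 / 2 ^ k) (refined_param k m - real_of_int i)"

section \<open>The two-scale relation of the coefficients\<close>

definition refine_mask :: "int \<Rightarrow> real" where
  "refine_mask m = (if even m then 3/4 else 1/4)"

text \<open>The mask (9, 3, 3, 1)/16 is the product of (3, 1)/4 with itself. The parity of each
  index selects the face corner, hence which of the two old neighbours receives the weight
  3/4.\<close>

lemma refine_tensor:
  "refine V m n =
     refine_mask m *\<^sub>R (refine_mask n *\<^sub>R V (m div 2) (n div 2)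
        + (1 - refine_mask n) *\<^sub>R V (m div 2) (n div 2 + 1))
     + (1 - refine_mask m) *\<^sub>R (refine_mask n *\<^sub>R V (m div 2 + 1) (n div 2)
        + (1 - refine_mask n) *\<^sub>R V (m div 2 + 1) (n div 2 + 1))"
  by (simp add: refine_def refined_face_def face_def refine_mask_def scaleR_add_right)

lemma int_parity_div:
  fixes m :: int
  shows "m = 2 * (m div 2) + (if even m then 0 else 1)"
  by simp

text \<open>For both parities the new index m sits at the old index position m/2 + 1/4. The fixed
  point of this map is 1/2, which explains the two offsets in \<open>refined_param\<close>.\<close>

lemma refined_param_Suc:
  "refined_param (Suc k) m = refine_mask m * refined_param k (m div 2)
     + (1 - refine_mask m) * refined_param k (m div 2 + 1)"
proof -
  obtain z where "m = 2 * z \<or> m = 2 * z + 1" by (metis int_parity_div add.right_neutral)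
  then show ?thesis
    by (auto simp: refined_param_def refine_mask_def field_simps)
qed

lemma refine_funpow_param:
  "(refine ^^ k) (\<lambda>i j. (real_of_int i, real_of_int j)) m n
     = (refined_param k m, refined_param k n)"
proof (induction k arbitrary: m n)
  case (Suc k)
  show ?case
    unfolding funpow.simps comp_apply refine_tensor[of _ m n] Suc refined_param_Suc
    by (simp add: algebra_simps)
qed (simp add: refined_param_def)

text \<open>The values on the right are polar values at the knot pairs (y - h/2, y + h/2) and (y +
  h/2, y + 3h/2). Both new pairs, (y, y + h/2) and (y + h/2, y + h), share the knot y + h/2 = hz, so
  affinity in the other argument gives the weights. As all old knots are multiples of h, the break
  point 0 is never strictly inside a pair; for z = 0 it is the shared knot and all values
  vanish.\<close>

lemma trunc_square_two_scale:
  fixes h :: real and z :: int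
  assumes "0 < h" and y: "y = h * (real_of_int z - 1/2)"
  shows "trunc_square (h / 2) (y + h / 4) = 3/4 * trunc_square h y + 1/4 * trunc_square h (y + h)"
    and "trunc_square (h / 2) (y + 3 * h / 4) = 1/4 * trunc_square h y + 3/4 * trunc_square h (y + h)"
proof -
  consider "z \<ge> 1" | "z = 0" | "z \<le> -1" by linarith
  then have "trunc_square (h / 2) (y + h / 4) = 3/4 * trunc_square h y + 1/4 * trunc_square h (y + h) \<and>
    trunc_square (h / 2) (y + 3 * h / 4) = 1/4 * trunc_square h y + 3/4 * trunc_square h (y + h)"
  proof cases
    case 1
    then have "h * (1/2) \<le> y" unfolding y using assms by (intro mult_left_mono) auto
    then show ?thesis using assms(1)
      by (auto simp: trunc_square_def power2_eq_square field_simps)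
  next
    case 2
    then show ?thesis using assms(1) unfolding y
      by (auto simp: trunc_square_def power2_eq_square field_simps)
  next
    case 3
    then have "real_of_int z \<le> -1" by linarith
    then have "y \<le> h * (-3/2)" unfolding y using assms by (intro mult_left_mono) auto
    then show ?thesis using assms(1)
      by (auto simp: trunc_square_def)
  qed
  then show "trunc_square (h / 2) (y + h / 4) = 3/4 * trunc_square h y + 1/4 * trunc_square h (y + h)"
    and "trunc_square (h / 2) (y + 3 * h / 4) = 1/4 * trunc_square h y + 3/4 * trunc_square h (y + h)"
    by auto
qed

text \<open>Subtracting i + 1/2 moves an original knot to the origin; relative to it the parameters
  of level k lie midway between multiples of the spacing, as the two-scale rule requires.\<close>

lemma trunc_square_refine:
  "trunc_square (1 / 2 ^ Suc k) (refined_param (Suc k) m - real_of_int i - 1/2)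
    = refine_mask m * trunc_square (1 / 2 ^ k) (refined_param k (m div 2) - real_of_int i - 1/2)
      + (1 - refine_mask m) * trunc_square (1 / 2 ^ k) (refined_param k (m div 2 + 1) - real_of_int i - 1/2)"
proof -
  define h :: real where "h = 1 / 2 ^ k"
  define z where "z = m div 2"
  define y where "y = refined_param k z - real_of_int i - 1/2"
  have h: "0 < h" by (simp add: h_def)
  have "y = h * (real_of_int (z - 2 ^ k * i) - 1/2)"
    by (simp add: y_def h_def refined_param_def field_simps)
  note two_scale = trunc_square_two_scale[OF h this]
  have 1: "refined_param k (z + 1) - real_of_int i - 1/2 = y + h"
    by (simp add: y_def h_def refined_param_def field_simps)
  have 2: "1 / 2 ^ Suc k = h / 2" by (simp add: h_def)
  have m: "m = 2 * z + (if even m then 0 else 1)" unfolding z_def by (rule int_parity_div)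
  have 3: "refined_param (Suc k) m - real_of_int i - 1/2 = y + (if even m then h / 4 else 3 * h / 4)"
    by (subst m) (simp add: y_def h_def refined_param_def field_simps)
  show ?thesis
    unfolding z_def[symmetric] h_def[symmetric] 1 2 3 y_def[symmetric]
    using two_scale by (auto simp: refine_mask_def)
qed

lemma refined_coeff_Suc:
  "refined_coeff (Suc k) m i = refine_mask m * refined_coeff k (m div 2) i
     + (1 - refine_mask m) * refined_coeff k (m div 2 + 1) i"
proof -
  \<comment> \<open>Changing i by an integer turns each of the four shifts of the third difference
    into the single shift -1/2 already treated.\<close>
  have shift: "x - real_of_int i + 3/2 = x - real_of_int (i - 2) - 1/2"
    "x - real_of_int i + 1/2 = x - real_of_int (i - 1) - 1/2"
    "x - real_of_int i - 3/2 = x - real_of_int (i + 1) - 1/2" for x :: real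
    by simp_all
  show ?thesis
    unfolding refined_coeff_def spline_blossom_def shift trunc_square_refine by (simp add: field_simps)
qed

text \<open>Dual functional property: the polar form at consecutive original knots returns the
  control coefficients, which for one basis function are a Kronecker delta.\<close>

lemma refined_coeff_0: "refined_coeff 0 m i = (if i = m then 1 else 0)"
proof (cases "\<bar>m - i\<bar> \<le> 1")
  case True
  then consider "m = i" | "m = i + 1" | "m = i - 1" by linarith
  then show ?thesis
    by cases (auto simp: refined_coeff_def refined_param_def spline_blossom_def trunc_square_def power2_eq_square)
next
  case False
  then have "2 \<le> \<bar>real_of_int m - real_of_int i\<bar>" by linarith
  then show ?thesis
    using False by (auto simp: refined_coeff_def refined_param_def intro!: spline_blossom_eq_0)
qed

text \<open>Summing over all index pairs keeps the induction purely linear, with no tracking of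
  supports through the levels.\<close>

lemma refine_funpow_has_sum:
  fixes V :: "int \<Rightarrow> int \<Rightarrow> 'a::real_normed_vector"
  shows "((\<lambda>(i, j). (refined_coeff k m i * refined_coeff k n j) *\<^sub>R V i j)
           has_sum (refine ^^ k) V m n) UNIV"
proof (induction k arbitrary: m n)
  case 0
  have "((\<lambda>(i, j). (refined_coeff 0 m i * refined_coeff 0 n j) *\<^sub>R V i j) has_sum V m n) {(m, n)}"
    by (rule has_sum_finiteI) (auto simp: refined_coeff_0)
  then show ?case
    by (subst has_sum_cong_neutral[where T = "{(m, n)}"]) (auto simp: refined_coeff_0 split: if_splits)
next
  case (Suc k)
  have "((\<lambda>p. refine_mask m *\<^sub>R
       (refine_mask n *\<^sub>R (case p of (i, j) \<Rightarrow> (refined_coeff k (m div 2) i * refined_coeff k (n div 2) j) *\<^sub>R V i j)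
        + (1 - refine_mask n) *\<^sub>R (case p of (i, j) \<Rightarrow> (refined_coeff k (m div 2) i * refined_coeff k (n div 2 + 1) j) *\<^sub>R V i j))
     + (1 - refine_mask m) *\<^sub>R
       (refine_mask n *\<^sub>R (case p of (i, j) \<Rightarrow> (refined_coeff k (m div 2 + 1) i * refined_coeff k (n div 2) j) *\<^sub>R V i j)
        + (1 - refine_mask n) *\<^sub>R (case p of (i, j) \<Rightarrow> (refined_coeff k (m div 2 + 1) i * refined_coeff k (n div 2 + 1) j) *\<^sub>R V i j)))
     has_sum (refine ^^ Suc k) V m n) UNIV"
    unfolding funpow.simps comp_apply refine_tensor[of _ m n]
    by (intro has_sum_add has_sum_scaleR Suc)
  moreover have "(\<lambda>p. refine_mask m *\<^sub>R
       (refine_mask n *\<^sub>R (case p of (i, j) \<Rightarrow> (refined_coeff k (m div 2) i * refined_coeff k (n div 2) j) *\<^sub>R V i j)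
        + (1 - refine_mask n) *\<^sub>R (case p of (i, j) \<Rightarrow> (refined_coeff k (m div 2) i * refined_coeff k (n div 2 + 1) j) *\<^sub>R V i j))
     + (1 - refine_mask m) *\<^sub>R
       (refine_mask n *\<^sub>R (case p of (i, j) \<Rightarrow> (refined_coeff k (m div 2 + 1) i * refined_coeff k (n div 2) j) *\<^sub>R V i j)
        + (1 - refine_mask n) *\<^sub>R (case p of (i, j) \<Rightarrow> (refined_coeff k (m div 2 + 1) i * refined_coeff k (n div 2 + 1) j) *\<^sub>R V i j)))
    = (\<lambda>(i, j). (refined_coeff (Suc k) m i * refined_coeff (Suc k) n j) *\<^sub>R V i j)"
    unfolding refined_coeff_Suc by (auto simp: fun_eq_iff simp flip: scaleR_add_left) (simp add: algebra_simps)
  ultimately show ?case by simp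
qed

section \<open>Convergence of the refined nets\<close>

text \<open>This permits replacing a net by its zero extension, so that sums over all integer pairs
  see only the mesh.\<close>

lemma refine_funpow_cong:
  assumes "\<And>i j. i \<in> I \<Longrightarrow> j \<in> J \<Longrightarrow> V i j = V' i j"
    and "m \<in> (refine_index ^^ k) I" "n \<in> (refine_index ^^ k) J"
  shows "(refine ^^ k) V m n = (refine ^^ k) V' m n"
  using assms(2,3)
proof (induction k arbitrary: m n)
  case (Suc k)
  have "m div 2 \<in> (refine_index ^^ k) I" "m div 2 + 1 \<in> (refine_index ^^ k) I"
    "n div 2 \<in> (refine_index ^^ k) J" "n div 2 + 1 \<in> (refine_index ^^ k) J"
    using Suc.prems by (simp_all add: refine_index_def[of "(refine_index ^^ k) _"])
  then show ?case
    unfolding funpow.simps comp_apply refine_tensor[of _ m n] by (simp add: Suc.IH)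
qed (use assms in simp)

text \<open>Two different representations exist only where the parameter is an integer, and there
  both sides are the value of \<open>g\<close> at that integer. This makes the definite description
  in \<open>bilinear_interpolant\<close> meaningful on shared edges.\<close>

lemma linear_interpolation_unique:
  fixes g :: "int \<Rightarrow> 'a::real_vector"
  assumes "a \<in> {0..1}" "a' \<in> {0..1}" "real_of_int m + a = real_of_int m' + a'"
  shows "(1 - a) *\<^sub>R g m + a *\<^sub>R g (m + 1) = (1 - a') *\<^sub>R g m' + a' *\<^sub>R g (m' + 1)"
proof -
  have "\<bar>real_of_int m - real_of_int m'\<bar> \<le> 1" using assms by auto
  then have "\<bar>m - m'\<bar> \<le> 1" by linarith
  then consider "m = m'" | "m' = m + 1" | "m = m' + 1" by linarith
  then show ?thesis
  proof cases
    case 2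
    then have "a = 1 \<and> a' = 0" using assms by auto
    then show ?thesis using 2 by simp
  next
    case 3
    then have "a = 0 \<and> a' = 1" using assms by auto
    then show ?thesis using 3 by simp
  qed (use assms in auto)
qed

lemma bilinear_patch_face:
  "bilinear_patch (face V m n) a b =
     (1 - a) *\<^sub>R ((1 - b) *\<^sub>R V m n + b *\<^sub>R V m (n + 1))
     + a *\<^sub>R ((1 - b) *\<^sub>R V (m + 1) n + b *\<^sub>R V (m + 1) (n + 1))"
  by (simp add: bilinear_patch_def face_def algebra_simps)

lemma bilinear_patch_unique:
  assumes "a \<in> {0..1}" "a' \<in> {0..1}" "real_of_int m + a = real_of_int m' + a'"
    and "b \<in> {0..1}" "b' \<in> {0..1}" "real_of_int n + b = real_of_int n' + b'"
  shows "bilinear_patch (face V m n) a b = bilinear_patch (face V m' n') a' b'"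
  unfolding bilinear_patch_face
  using linear_interpolation_unique[OF assms(1-3), of "\<lambda>m. (1 - b) *\<^sub>R V m n + b *\<^sub>R V m (n + 1)"]
    linear_interpolation_unique[OF assms(4-6), of "V m'"]
    linear_interpolation_unique[OF assms(4-6), of "V (m' + 1)"] by simp

lemma bilinear_patch_refined_param:
  "bilinear_patch (face (\<lambda>m n. (refined_param k m, refined_param k n)) m n) a b
     = ((real_of_int m + a - 1/2) / 2 ^ k + 1/2, (real_of_int n + b - 1/2) / 2 ^ k + 1/2)"
  by (simp add: bilinear_patch_face refined_param_def field_simps)

lemma refined_interpolant_eq:
  assumes "(m, n) \<in> faces ((refine_index ^^ k) I) ((refine_index ^^ k) J)"
    and "a \<in> {0..1}" "b \<in> {0..1}"
  shows "refined_interpolant I J V k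
      ((real_of_int m + a - 1/2) / 2 ^ k + 1/2, (real_of_int n + b - 1/2) / 2 ^ k + 1/2)
    = bilinear_patch (face ((refine ^^ k) V) m n) a b"
proof -
  have param: "(refine ^^ k) (\<lambda>i j. (real_of_int i, real_of_int j))
      = (\<lambda>m n. (refined_param k m, refined_param k n))"
    by (intro ext refine_funpow_param)
  show ?thesis
    unfolding refined_interpolant_def bilinear_interpolant_def param
  proof (rule the_equality)
    show "\<exists>(m', n')\<in>faces ((refine_index ^^ k) I) ((refine_index ^^ k) J). \<exists>a'\<in>{0..1}. \<exists>b'\<in>{0..1}.
       ((real_of_int m + a - 1/2) / 2 ^ k + 1/2, (real_of_int n + b - 1/2) / 2 ^ k + 1/2)
       = bilinear_patch (face (\<lambda>m n. (refined_param k m, refined_param k n)) m' n') a' b' \<and>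
       bilinear_patch (face ((refine ^^ k) V) m n) a b = bilinear_patch (face ((refine ^^ k) V) m' n') a' b'"
      using assms unfolding bilinear_patch_refined_param by blast
  next
    fix z
    assume "\<exists>(m', n')\<in>faces ((refine_index ^^ k) I) ((refine_index ^^ k) J). \<exists>a'\<in>{0..1}. \<exists>b'\<in>{0..1}.
       ((real_of_int m + a - 1/2) / 2 ^ k + 1/2, (real_of_int n + b - 1/2) / 2 ^ k + 1/2)
       = bilinear_patch (face (\<lambda>m n. (refined_param k m, refined_param k n)) m' n') a' b' \<and>
       z = bilinear_patch (face ((refine ^^ k) V) m' n') a' b'"
    then obtain m' n' a' b' where *: "a' \<in> {0..1}" "b' \<in> {0..1}"
       "real_of_int m + a = real_of_int m' + a'" "real_of_int n + b = real_of_int n' + b'"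
       "z = bilinear_patch (face ((refine ^^ k) V) m' n') a' b'"
      unfolding bilinear_patch_refined_param by auto
    show "z = bilinear_patch (face ((refine ^^ k) V) m n) a b"
      unfolding *(5) by (rule bilinear_patch_unique) (use * assms in auto)
  qed
qed

section \<open>Index sets of the refined nets and the parameter interval\<close>

lemma index_intervalI:
  assumes "index_interval I" "bdd_below I \<Longrightarrow> Inf I \<le> z" "bdd_above I \<Longrightarrow> z \<le> Sup I"
  shows "z \<in> I"
proof -
  have ne: "I \<noteq> {}" using assms(1) by (auto simp: index_interval_def)
  have "\<exists>a\<in>I. a \<le> z"
  proof (cases "bdd_below I")
    case True
    then show ?thesis using assms(2) cInf_greatest[OF ne, of "z + 1"] by force
  next
    case False
    then show ?thesis by (meson bdd_belowI linear)
  qed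
  moreover have "\<exists>b\<in>I. z \<le> b"
  proof (cases "bdd_above I")
    case True
    then show ?thesis using assms(3) cSup_least[OF ne, of "z - 1"] by force
  next
    case False
    then show ?thesis by (meson bdd_aboveI linear)
  qed
  ultimately show ?thesis using assms(1) unfolding index_interval_def by fastforce
qed

text \<open>For I = {a..b} the k-th index set is {2^k a..2^k (b - 1) + 1}. The two quotients express
  these bounds through membership in \<open>I\<close>, which also covers unbounded sides.\<close>

lemma refine_index_funpowI:
  assumes I: "index_interval I"
    and "m div 2 ^ k \<in> I" "(m - 2) div 2 ^ k + 2 \<in> I"
  shows "m \<in> (refine_index ^^ k) I"
  using assms(2,3)
proof (induction k arbitrary: m)
  case (Suc k)
  define z where "z = m div 2"
  have conv: "t \<in> I" if "s \<in> I" "u \<in> I" "s \<le> t" "t \<le> u" for s t u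
    using I that unfolding index_interval_def by fastforce
  have half: "(m - 2) div 2 = m div 2 - 1" by presburger
  have eq: "m div 2 ^ Suc k = z div 2 ^ k" "(m - 2) div 2 ^ Suc k + 2 = (z - 1) div 2 ^ k + 2"
    by (simp_all add: z_def zdiv_zmult2_eq half)
  have pos: "(0::int) < 2 ^ k" by simp
  have one: "(1::int) \<le> 2 ^ k" by simp
  have add2: "x div 2 ^ k + 2 = (x + 2 * 2 ^ k) div 2 ^ k" for x :: int by simp
  \<comment> \<open>The quotients still needed for z and z + 1 are enclosed between the two given
    members of \<open>I\<close>.\<close>
  have 1: "z div 2 ^ k \<le> (z - 2) div 2 ^ k + 2" "(z - 2) div 2 ^ k + 2 \<le> (z - 1) div 2 ^ k + 2"
    unfolding add2 using one by (intro zdiv_mono1 pos; linarith)+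
  have 2: "z div 2 ^ k \<le> (z + 1) div 2 ^ k" "(z + 1) div 2 ^ k \<le> (z - 1) div 2 ^ k + 2"
    unfolding add2 using one by (intro zdiv_mono1 pos; linarith)+
  note mem = Suc.prems[unfolded eq]
  have "z \<in> (refine_index ^^ k) I" "z + 1 \<in> (refine_index ^^ k) I"
    using Suc.IH[of z] Suc.IH[of "z + 1"] conv[OF mem 1] conv[OF mem 2] mem by auto
  then show ?case by (simp add: refine_index_def[of "(refine_index ^^ k) _"] z_def)
qed simp

text \<open>In units of the level-k index, the parameter interval runs from Inf I * 2^k + 1/2 to
  (Sup I - 1) * 2^k + 1/2, whereas the indices run from Inf I * 2^k to (Sup I - 1) * 2^k + 1. The
  grid thus overhangs by half a cell at each bounded end.\<close>

lemma param_interval_cell: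
  assumes I: "index_interval I" and x: "x \<in> param_interval I"
  obtains m a where "m \<in> (refine_index ^^ k) I" "m + 1 \<in> (refine_index ^^ k) I" "a \<in> {0..1}"
    "x = (real_of_int m + a - 1/2) / 2 ^ k + 1/2"
proof -
  \<comment> \<open>The real index at which the affine extension of \<open>refined_param k\<close>
    takes the value x.\<close>
  define t where "t = (x - 1/2) * 2 ^ k + 1/2"
  define m where "m = \<lfloor>t\<rfloor>"
  have tm: "real_of_int m \<le> t" "t < real_of_int m + 1" unfolding m_def by linarith+
  have pos: "(0::int) < 2 ^ k" by simp
  have lower: "Inf I * 2 ^ k \<le> m" if "bdd_below I"
  proof -
    have "real_of_int (Inf I) * 2 ^ k \<le> (x - 1/2) * 2 ^ k"
      using x that by (intro mult_right_mono) (auto simp: param_interval_def)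
    then have "real_of_int (Inf I * 2 ^ k) < real_of_int (m + 1)"
      using tm unfolding t_def of_int_mult of_int_power of_int_add of_int_1 of_int_numeral by linarith
    then show ?thesis by linarith
  qed
  have upper: "m \<le> (Sup I - 1) * 2 ^ k" if "bdd_above I"
  proof -
    have "(x - 1/2) * 2 ^ k \<le> (real_of_int (Sup I) - 1) * 2 ^ k"
      using x that by (intro mult_right_mono) (auto simp: param_interval_def)
    then have "real_of_int m < real_of_int ((Sup I - 1) * 2 ^ k + 1)"
      using tm unfolding t_def of_int_mult of_int_power of_int_add of_int_diff of_int_1 of_int_numeral
      by linarith
    then show ?thesis by linarith
  qed
  have mem: "z div 2 ^ k \<in> I \<and> (z - 2) div 2 ^ k + 2 \<in> I" if "z = m \<or> z = m + 1" for z
  proof (intro conjI index_intervalI[OF I])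
    have pow: "(1::int) \<le> 2 ^ k" by simp
    show "Inf I \<le> z div 2 ^ k" if "bdd_below I"
      using lower[OF that] \<open>z = m \<or> z = m + 1\<close> zdiv_mono1[OF _ pos, of "Inf I * 2 ^ k" z] by auto
    show "z div 2 ^ k \<le> Sup I" if "bdd_above I"
    proof -
      have "z \<le> Sup I * 2 ^ k"
        using upper[OF that] \<open>z = m \<or> z = m + 1\<close> pow unfolding left_diff_distrib by linarith
      then show ?thesis using zdiv_mono1[OF _ pos, of z "Sup I * 2 ^ k"] by simp
    qed
    show "Inf I \<le> (z - 2) div 2 ^ k + 2" if "bdd_below I"
    proof -
      have "(Inf I - 2) * 2 ^ k \<le> z - 2"
        using lower[OF that] \<open>z = m \<or> z = m + 1\<close> pow unfolding left_diff_distrib by linarith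
      then show ?thesis using zdiv_mono1[OF _ pos, of "(Inf I - 2) * 2 ^ k" "z - 2"] by simp
    qed
    have "(z - 2) div 2 ^ k < Sup I - 1" if "bdd_above I"
    proof -
      have "(z - 2) div 2 ^ k * 2 ^ k \<le> z - 2"
        using div_mult_mod_eq[of "z - 2" "2 ^ k"] pos_mod_sign[OF pos, of "z - 2"] by linarith
      also have "\<dots> < (Sup I - 1) * 2 ^ k"
        using upper[OF that] \<open>z = m \<or> z = m + 1\<close> by linarith
      finally show ?thesis by simp
    qed
    then show "(z - 2) div 2 ^ k + 2 \<le> Sup I" if "bdd_above I" using that by linarith
  qed
  show thesis
  proof (rule that[of m "t - m"])
    show "m \<in> (refine_index ^^ k) I" "m + 1 \<in> (refine_index ^^ k) I"
      using mem by (auto intro!: refine_index_funpowI[OF I])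
    show "t - m \<in> {0..1}" using tm by auto
    show "x = (real_of_int m + (t - m) - 1/2) / 2 ^ k + 1/2"
      by (simp add: t_def)
  qed
qed

section \<open>Localization to finite windows and the error estimate\<close>

lemma finite_near_ints: "finite {i. \<bar>x - real_of_int i\<bar> \<le> r}"
proof (rule finite_subset)
  show "{i. \<bar>x - real_of_int i\<bar> \<le> r} \<subseteq> {\<lfloor>x - r\<rfloor>..\<lceil>x + r\<rceil>}"
    by (auto simp: abs_le_iff) linarith+
qed simp

text \<open>Radius 4 = 3 + 1: near \<open>x\<close>, i.e. at distance less than 1, only control points in
  this window influence the spline and all the interpolants.\<close>

definition window :: "real \<times> real \<Rightarrow> (int \<times> int) set" where
  "window x = {i. \<bar>fst x - real_of_int i\<bar> \<le> 4} \<times> {j. \<bar>snd x - real_of_int j\<bar> \<le> 4}"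

lemma finite_window: "finite (window x)"
  unfolding window_def by (intro finite_cartesian_product finite_near_ints)

text \<open>The finite windows can reach beyond the mesh, where the values of a net are
  unspecified.\<close>

definition zero_ext :: "int set \<Rightarrow> int set \<Rightarrow> (int \<Rightarrow> int \<Rightarrow> 'a::zero) \<Rightarrow> int \<Rightarrow> int \<Rightarrow> 'a" where
  "zero_ext I J V i j = (if i \<in> I \<and> j \<in> J then V i j else 0)"

lemma ball_prod_components:
  assumes "x \<in> ball x0 (e::real)"
  shows "\<bar>fst x - fst x0\<bar> < e" "\<bar>snd x - snd x0\<bar> < e"
  using assms dist_fst_le[of x0 x] dist_snd_le[of x0 x] by (auto simp: dist_real_def)

lemma S_hat_eq_sum:
  assumes "x \<in> ball x0 1"
  shows "S_hat I J V x = (\<Sum>(i, j)\<in>window x0.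
    (N_spline (fst x - real_of_int i) * N_spline (snd x - real_of_int j)) *\<^sub>R zero_ext I J V i j)"
proof -
  obtain u v where x: "x = (u, v)" by (cases x)
  have "S_hat I J V x = (\<Sum>\<^sub>\<infinity>(i, j)\<in>window x0.
    (N_spline (u - real_of_int i) * N_spline (v - real_of_int j)) *\<^sub>R zero_ext I J V i j)"
    unfolding S_hat_def x prod.case
    by (rule infsum_cong_neutral)
      (use ball_prod_components[OF assms] in \<open>auto simp: zero_ext_def x window_def intro!: N_spline_eq_0\<close>)
  then show ?thesis by (simp add: finite_window x)
qed

text \<open>The enclosing parameters are within h = 1/2^k of x. Moving the argument costs h by the
  Lipschitz bound, and passing from blossom to spline costs h^2 \<le> h. Since h \<le> 1, distance 3
  from x leaves distance 2 from these parameters.\<close>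

lemma refined_coeff_error:
  assumes "a \<in> {0..1}" and x: "x = (real_of_int m + a - 1/2) / 2 ^ k + 1/2"
  defines "L \<equiv> \<lambda>i. (1 - a) * refined_coeff k m i + a * refined_coeff k (m + 1) i"
  shows "\<bar>L i - N_spline (x - real_of_int i)\<bar> \<le> 2 / 2 ^ k"
    and "3 \<le> \<bar>x - real_of_int i\<bar> \<Longrightarrow> L i = 0"
proof -
  define h :: real where "h = 1 / 2 ^ k"
  have h: "0 < h" "h \<le> 1" by (simp_all add: h_def)
  have "a * h \<le> h" "0 \<le> a * h" using assms(1) h by (auto intro: mult_left_le_one_le)
  moreover have "x - refined_param k m = a * h" "refined_param k (m + 1) - x = h - a * h"
    by (simp_all add: x refined_param_def h_def field_simps)
  ultimately have near: "\<bar>refined_param k m - x\<bar> \<le> h" "\<bar>refined_param k (m + 1) - x\<bar> \<le> h"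
    by linarith+
  have "\<bar>refined_coeff k n i - N_spline (x - real_of_int i)\<bar> \<le> 2 * h"
    if "\<bar>refined_param k n - x\<bar> \<le> h" for n
  proof -
    have "h\<^sup>2 \<le> h" using h by (simp add: power2_eq_square mult_left_le_one_le)
    moreover have "\<bar>refined_coeff k n i - N_spline (refined_param k n - real_of_int i)\<bar> \<le> h\<^sup>2"
      unfolding refined_coeff_def h_def by (rule spline_blossom_error) simp
    ultimately show ?thesis
      using N_spline_lipschitz[of "refined_param k n - real_of_int i" "x - real_of_int i"] that
      by linarith
  qed
  note err = this[OF near(1)] this[OF near(2)]
  have "L i - N_spline (x - real_of_int i) = (1 - a) * (refined_coeff k m i - N_spline (x - real_of_int i))
      + a * (refined_coeff k (m + 1) i - N_spline (x - real_of_int i))"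
    by (simp add: L_def algebra_simps)
  also have "\<bar>\<dots>\<bar> \<le> 2 * h"
  proof (rule order_trans[OF abs_triangle_ineq])
    show "\<bar>(1 - a) * (refined_coeff k m i - N_spline (x - real_of_int i))\<bar>
      + \<bar>a * (refined_coeff k (m + 1) i - N_spline (x - real_of_int i))\<bar> \<le> 2 * h"
      unfolding abs_mult using assms(1) convex_bound_le[OF err, of "1 - a" a] by simp
  qed
  finally show "\<bar>L i - N_spline (x - real_of_int i)\<bar> \<le> 2 / 2 ^ k" by (simp add: h_def)
  assume "3 \<le> \<bar>x - real_of_int i\<bar>"
  then have "2 \<le> \<bar>refined_param k m - real_of_int i\<bar>" "2 \<le> \<bar>refined_param k (m + 1) - real_of_int i\<bar>"
    using near h by linarith+
  then show "L i = 0"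
    using h by (simp add: L_def refined_coeff_def h_def[symmetric] spline_blossom_eq_0)
qed

text \<open>Bilinear interpolation of product coefficients factors into univariate interpolants
  \<open>L i * M j\<close>, so the comparison with the spline takes place coefficient by
  coefficient.\<close>

lemma refined_interpolant_error:
  fixes V :: "int \<Rightarrow> int \<Rightarrow> hvec"
  assumes I: "index_interval I" and J: "index_interval J"
    and x: "x \<in> param_domain I J" "x \<in> ball x0 1"
  shows "dist (refined_interpolant I J V k x) (S_hat I J V x)
    \<le> 8 / 2 ^ k * (\<Sum>(i, j)\<in>window x0. norm (zero_ext I J V i j))"
proof -
  obtain u v where uv: "x = (u, v)" "u \<in> param_interval I" "v \<in> param_interval J"
    using x by (auto simp: param_domain_def)
  obtain m a where m: "m \<in> (refine_index ^^ k) I" "m + 1 \<in> (refine_index ^^ k) I" "a \<in> {0..1}"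
    "u = (real_of_int m + a - 1/2) / 2 ^ k + 1/2"
    using param_interval_cell[OF I uv(2)] .
  obtain n b where n: "n \<in> (refine_index ^^ k) J" "n + 1 \<in> (refine_index ^^ k) J" "b \<in> {0..1}"
    "v = (real_of_int n + b - 1/2) / 2 ^ k + 1/2"
    using param_interval_cell[OF J uv(3)] .
  define V' where "V' = zero_ext I J V"
  define L where "L i = (1 - a) * refined_coeff k m i + a * refined_coeff k (m + 1) i" for i
  define M where "M j = (1 - b) * refined_coeff k n j + b * refined_coeff k (n + 1) j" for j
  have cong: "(refine ^^ k) V m' n' = (refine ^^ k) V' m' n'"
    if "m' \<in> (refine_index ^^ k) I" "n' \<in> (refine_index ^^ k) J" for m' n'
    using that by (intro refine_funpow_cong) (auto simp: V'_def zero_ext_def)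
  have "refined_interpolant I J V k x = bilinear_patch (face ((refine ^^ k) V) m n) a b"
    unfolding uv m n by (rule refined_interpolant_eq) (use m n in \<open>auto simp: faces_def\<close>)
  also have "\<dots> = bilinear_patch (face ((refine ^^ k) V') m n) a b"
    unfolding bilinear_patch_face using m n by (simp add: cong)
  finally have F: "refined_interpolant I J V k x = \<dots>" .
  have "((\<lambda>p. (1 - a) *\<^sub>R
       ((1 - b) *\<^sub>R (case p of (i, j) \<Rightarrow> (refined_coeff k m i * refined_coeff k n j) *\<^sub>R V' i j)
        + b *\<^sub>R (case p of (i, j) \<Rightarrow> (refined_coeff k m i * refined_coeff k (n + 1) j) *\<^sub>R V' i j))
     + a *\<^sub>R
       ((1 - b) *\<^sub>R (case p of (i, j) \<Rightarrow> (refined_coeff k (m + 1) i * refined_coeff k n j) *\<^sub>R V' i j)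
        + b *\<^sub>R (case p of (i, j) \<Rightarrow> (refined_coeff k (m + 1) i * refined_coeff k (n + 1) j) *\<^sub>R V' i j)))
     has_sum refined_interpolant I J V k x) UNIV"
    unfolding F bilinear_patch_face
    by (intro has_sum_add has_sum_scaleR refine_funpow_has_sum)
  moreover have "(\<lambda>p. (1 - a) *\<^sub>R
       ((1 - b) *\<^sub>R (case p of (i, j) \<Rightarrow> (refined_coeff k m i * refined_coeff k n j) *\<^sub>R V' i j)
        + b *\<^sub>R (case p of (i, j) \<Rightarrow> (refined_coeff k m i * refined_coeff k (n + 1) j) *\<^sub>R V' i j))
     + a *\<^sub>R
       ((1 - b) *\<^sub>R (case p of (i, j) \<Rightarrow> (refined_coeff k (m + 1) i * refined_coeff k n j) *\<^sub>R V' i j)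
        + b *\<^sub>R (case p of (i, j) \<Rightarrow> (refined_coeff k (m + 1) i * refined_coeff k (n + 1) j) *\<^sub>R V' i j)))
     = (\<lambda>(i, j). (L i * M j) *\<^sub>R V' i j)"
    unfolding L_def M_def by (auto simp: fun_eq_iff simp flip: scaleR_add_left) (simp add: algebra_simps)
  ultimately have "((\<lambda>(i, j). (L i * M j) *\<^sub>R V' i j) has_sum refined_interpolant I J V k x) UNIV"
    by simp
  also have "?this \<longleftrightarrow> ((\<lambda>(i, j). (L i * M j) *\<^sub>R V' i j) has_sum refined_interpolant I J V k x) (window x0)"
  proof (rule has_sum_cong_neutral)
    fix p assume "p \<in> UNIV - window x0"
    then have "3 \<le> \<bar>u - real_of_int (fst p)\<bar> \<or> 3 \<le> \<bar>v - real_of_int (snd p)\<bar>"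
      using ball_prod_components[OF x(2)] by (cases p) (auto simp: window_def uv)
    then have "L (fst p) = 0 \<or> M (snd p) = 0"
      using refined_coeff_error(2)[OF m(3,4)] refined_coeff_error(2)[OF n(3,4)]
      unfolding L_def M_def by blast
    then show "(case p of (i, j) \<Rightarrow> (L i * M j) *\<^sub>R V' i j) = 0"
      by (auto simp: case_prod_unfold)
  qed auto
  finally have R: "refined_interpolant I J V k x = (\<Sum>(i, j)\<in>window x0. (L i * M j) *\<^sub>R V' i j)"
    using has_sum_unique[OF _ has_sum_finite[OF finite_window]] by blast
  \<comment> \<open>Each factor errs by at most e \<le> 2, so \<bar>M j\<bar> \<le> 3 and the
    product errs by at most 3e + e = 8/2^k.\<close>
  define e :: real where "e = 2 / 2 ^ k"
  have e: "0 \<le> e" "e \<le> 2" by (simp_all add: e_def field_simps)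
  have coeff: "\<bar>L i * M j - N_spline (u - real_of_int i) * N_spline (v - real_of_int j)\<bar> \<le> 8 / 2 ^ k" for i j
  proof -
    let ?p = "N_spline (u - real_of_int i)" and ?q = "N_spline (v - real_of_int j)"
    have L: "\<bar>L i - ?p\<bar> \<le> e" and M: "\<bar>M j - ?q\<bar> \<le> e"
      using refined_coeff_error(1)[OF m(3,4)] refined_coeff_error(1)[OF n(3,4)]
      by (simp_all add: L_def M_def e_def)
    have pq: "\<bar>?p\<bar> \<le> 1" "\<bar>?q\<bar> \<le> 1"
      using N_spline_nonneg N_spline_le_1 by (simp_all add: abs_le_iff add_increasing)
    have "\<bar>M j\<bar> \<le> 3" using M pq e by linarith
    then have "\<bar>(L i - ?p) * M j\<bar> \<le> e * 3" "\<bar>?p * (M j - ?q)\<bar> \<le> 1 * e"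
      unfolding abs_mult using L M pq e by (intro mult_mono; simp)+
    moreover have "L i * M j - ?p * ?q = (L i - ?p) * M j + ?p * (M j - ?q)"
      by (simp add: algebra_simps)
    ultimately show ?thesis by (simp add: e_def)
  qed
  have "refined_interpolant I J V k x - S_hat I J V x = (\<Sum>(i, j)\<in>window x0.
      (L i * M j - N_spline (u - real_of_int i) * N_spline (v - real_of_int j)) *\<^sub>R V' i j)"
    unfolding R S_hat_eq_sum[OF x(2)] V'_def[symmetric]
    by (simp add: uv(1) sum_subtractf case_prod_unfold scaleR_diff_left)
  also have "norm \<dots> \<le> (\<Sum>(i, j)\<in>window x0. 8 / 2 ^ k * norm (V' i j))"
    unfolding case_prod_unfold
  proof (rule sum_norm_le)
    fix p
    show "norm ((L (fst p) * M (snd p) - N_spline (u - real_of_int (fst p)) * N_spline (v - real_of_int (snd p)))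
        *\<^sub>R V' (fst p) (snd p)) \<le> 8 / 2 ^ k * norm (V' (fst p) (snd p))"
      unfolding norm_scaleR by (rule mult_right_mono[OF coeff norm_ge_zero])
  qed
  finally show ?thesis
    by (simp add: dist_norm V'_def sum_distrib_left case_prod_unfold)
qed

lemma locally_uniform_limit_refined_interpolant:
  fixes V :: "int \<Rightarrow> int \<Rightarrow> hvec"
  assumes "index_interval I" "index_interval J"
  shows "locally_uniform_limit (param_domain I J) (refined_interpolant I J V) (S_hat I J V)"
  unfolding locally_uniform_limit_def
proof (intro ballI exI[of _ 1] conjI uniform_limitI)
  fix x0 :: "real \<times> real" and e :: real
  assume "0 < e"
  have "(\<lambda>k. 8 / 2 ^ k * (\<Sum>(i, j)\<in>window x0. norm (zero_ext I J V i j))) \<longlonglongrightarrow> 0"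
    by (intro tendsto_mult_left_zero LIMSEQ_divide_realpow_zero) simp
  then have "\<forall>\<^sub>F k in sequentially. 8 / 2 ^ k * (\<Sum>(i, j)\<in>window x0. norm (zero_ext I J V i j)) < e"
    using \<open>0 < e\<close> by (rule order_tendstoD)
  then show "\<forall>\<^sub>F k in sequentially. \<forall>x\<in>ball x0 1 \<inter> param_domain I J.
      dist (refined_interpolant I J V k x) (S_hat I J V x) < e"
  proof eventually_elim
    case (elim k)
    show ?case
      by (intro ballI le_less_trans[OF refined_interpolant_error[OF assms] elim]) auto
  qed
qed simp

section \<open>Smoothness of the limit surface\<close>

text \<open>With \<open>f\<close> and \<open>g\<close> left open, the spline and both its partial
  derivatives are instances of one expression.\<close>

definition window_sum ::
  "int set \<Rightarrow> int set \<Rightarrow> (int \<Rightarrow> int \<Rightarrow> 'a::real_vector) \<Rightarrow> real \<times> real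
     \<Rightarrow> (real \<Rightarrow> real) \<Rightarrow> (real \<Rightarrow> real) \<Rightarrow> real \<times> real \<Rightarrow> 'a" where
  "window_sum I J V x0 f g x = (\<Sum>(i, j)\<in>window x0.
     (f (fst x - real_of_int i) * g (snd x - real_of_int j)) *\<^sub>R zero_ext I J V i j)"

lemma S_hat_eq_window_sum:
  "x \<in> ball x0 1 \<Longrightarrow> S_hat I J V x = window_sum I J V x0 N_spline N_spline x"
  unfolding window_sum_def by (rule S_hat_eq_sum)

lemma N_spline_compose_has_derivative:
  assumes "(g has_derivative g') (at x within D)"
  shows "((\<lambda>x. N_spline (g x)) has_derivative (\<lambda>h. g' h * N_spline' (g x))) (at x within D)"
  using DERIV_compose_FDERIV[OF N_spline_has_real_derivative assms] .

text \<open>One window serves the whole unit ball, so the spline is a fixed finite sum near x and is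
  differentiated termwise.\<close>

lemma S_hat_has_derivative:
  fixes V :: "int \<Rightarrow> int \<Rightarrow> hvec"
  assumes "x \<in> ball x0 1"
  shows "(S_hat I J V has_derivative (\<lambda>h.
      fst h *\<^sub>R window_sum I J V x0 N_spline' N_spline x
      + snd h *\<^sub>R window_sum I J V x0 N_spline N_spline' x)) (at x)"
proof -
  have shift: "((\<lambda>x. fst x - c) has_derivative fst) (at x)"
    "((\<lambda>x. snd x - c) has_derivative snd) (at x)" for c :: real and x :: "real \<times> real"
    by (auto intro!: derivative_eq_intros)
  have "((\<lambda>x. window_sum I J V x0 N_spline N_spline x) has_derivative (\<lambda>h. \<Sum>p\<in>window x0.
      (N_spline (fst x - real_of_int (fst p)) * (snd h * N_spline' (snd x - real_of_int (snd p)))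
       + fst h * N_spline' (fst x - real_of_int (fst p)) * N_spline (snd x - real_of_int (snd p)))
      *\<^sub>R zero_ext I J V (fst p) (snd p))) (at x)"
    unfolding window_sum_def case_prod_unfold
    by (intro has_derivative_sum has_derivative_scaleR_left has_derivative_mult
        N_spline_compose_has_derivative shift)
  also have "(\<lambda>h. \<Sum>p\<in>window x0.
      (N_spline (fst x - real_of_int (fst p)) * (snd h * N_spline' (snd x - real_of_int (snd p)))
       + fst h * N_spline' (fst x - real_of_int (fst p)) * N_spline (snd x - real_of_int (snd p)))
      *\<^sub>R zero_ext I J V (fst p) (snd p)) = (\<lambda>h.
      fst h *\<^sub>R window_sum I J V x0 N_spline' N_spline x
      + snd h *\<^sub>R window_sum I J V x0 N_spline N_spline' x)"
    unfolding window_sum_def case_prod_unfold scaleR_sum_right sum.distrib[symmetric]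
    by (intro ext sum.cong) (simp_all add: scaleR_add_left mult_ac)
  finally show ?thesis
    by (rule has_derivative_transform_within_open[of _ _ _ _ "ball x0 1"])
      (use assms in \<open>simp_all add: S_hat_eq_window_sum\<close>)
qed

lemma continuous_on_window_sum:
  fixes V :: "int \<Rightarrow> int \<Rightarrow> hvec"
  assumes "continuous_on UNIV f" "continuous_on UNIV g"
  shows "continuous_on A (window_sum I J V x0 f g)"
  unfolding window_sum_def[abs_def] case_prod_unfold
  by (intro continuous_intros continuous_on_compose2[OF assms(1)] continuous_on_compose2[OF assms(2)]) auto

text \<open>Up to the factor \<open>1 / weight s ^ 2\<close>, the derivative of the central projection
  \<^const>\<open>point\<close> at \<open>s\<close> in direction \<open>d\<close>.\<close>

definition projected_dir :: "hvec \<Rightarrow> hvec \<Rightarrow> real ^ 3" where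
  "projected_dir s d = weight s *\<^sub>R fst d - weight d *\<^sub>R fst s"

lemma point_compose_has_derivative:
  assumes "(S has_derivative (\<lambda>h. fst h *\<^sub>R a + snd h *\<^sub>R b)) (at x within D)" "weight (S x) \<noteq> 0"
  shows "((\<lambda>x. point (S x)) has_derivative (\<lambda>h. fst h *\<^sub>R (projected_dir (S x) a /\<^sub>R (weight (S x))\<^sup>2)
     + snd h *\<^sub>R (projected_dir (S x) b /\<^sub>R (weight (S x))\<^sup>2))) (at x within D)"
proof -
  let ?w = "weight (S x)"
  have "((\<lambda>x. fst (S x)) has_derivative (\<lambda>h. fst h *\<^sub>R fst a + snd h *\<^sub>R fst b)) (at x within D)"
    using has_derivative_fst[OF assms(1)] by simp
  moreover have "((\<lambda>x. snd (S x)) has_derivative (\<lambda>h. fst h * snd a + snd h * snd b)) (at x within D)"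
    using has_derivative_snd[OF assms(1)] by simp
  note Deriv.has_derivative_inverse[OF assms(2) this]
  ultimately have "((\<lambda>x. point (S x)) has_derivative
    (\<lambda>h. inverse ?w *\<^sub>R (fst h *\<^sub>R fst a + snd h *\<^sub>R fst b)
      + (- (inverse ?w * (fst h * snd a + snd h * snd b) * inverse ?w)) *\<^sub>R fst (S x))) (at x within D)"
    unfolding point_def by (rule has_derivative_scaleR[rotated])
  moreover have "inverse ?w *\<^sub>R (r *\<^sub>R fst a + t *\<^sub>R fst b)
      + (- (inverse ?w * (r * snd a + t * snd b) * inverse ?w)) *\<^sub>R fst (S x)
    = r *\<^sub>R (projected_dir (S x) a /\<^sub>R ?w\<^sup>2) + t *\<^sub>R (projected_dir (S x) b /\<^sub>R ?w\<^sup>2)" for r t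
    using assms(2) by (simp add: vec_eq_iff projected_dir_def power2_eq_square field_simps)
  ultimately show ?thesis by simp
qed

definition partials_blinfun :: "'a::real_normed_vector \<Rightarrow> 'a \<Rightarrow> (real \<times> real) \<Rightarrow>\<^sub>L 'a" where
  "partials_blinfun a b = (blinfun_scaleR_left a o\<^sub>L fst_blinfun) + (blinfun_scaleR_left b o\<^sub>L snd_blinfun)"

lemma blinfun_apply_partials: "blinfun_apply (partials_blinfun a b) = (\<lambda>h. fst h *\<^sub>R a + snd h *\<^sub>R b)"
  by (auto simp: partials_blinfun_def plus_blinfun.rep_eq fst_blinfun.rep_eq snd_blinfun.rep_eq)

lemma continuous_on_partials_blinfun:
  "continuous_on A f \<Longrightarrow> continuous_on A g \<Longrightarrow> continuous_on A (\<lambda>x. partials_blinfun (f x) (g x))"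
  unfolding partials_blinfun_def
  by (intro continuous_intros bounded_linear.continuous_on[OF bounded_linear_blinfun_scaleR_left]
      bounded_bilinear.continuous_on[OF bounded_bilinear_blinfun_compose])

text \<open>Explicit derivative formulas depend on the window around \<open>x0\<close>. Uniqueness
  of the derivative at points of an open set identifies all of them with the canonical
  \<open>g\<close>, so they glue.\<close>

lemma C1_on_if_locally:
  assumes "\<And>x0. x0 \<in> D \<Longrightarrow> \<exists>U f'. open U \<and> x0 \<in> U \<and>
    (\<forall>x\<in>U. (f has_derivative blinfun_apply (f' x)) (at x)) \<and> continuous_on U f'"
  shows "C1_on f D"
proof -
  define g where "g x = Blinfun (frechet_derivative f (at x))" for x
  have "(f has_derivative blinfun_apply (g x0)) (at x0 within D) \<and> continuous (at x0 within D) g"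
    if x0: "x0 \<in> D" for x0
  proof -
    obtain U f' where U: "open U" "x0 \<in> U"
      and der: "\<And>x. x \<in> U \<Longrightarrow> (f has_derivative blinfun_apply (f' x)) (at x)"
      and cont: "continuous_on U f'"
      using assms[OF x0] by blast
    have g: "g x = f' x" if "x \<in> U" for x
      unfolding g_def frechet_derivative_at[OF der[OF that], symmetric] by (rule blinfun_apply_inverse)
    then have "continuous_on U g" using cont continuous_on_cong by fastforce
    then have "isCont g x0" using U by (simp add: continuous_on_eq_continuous_at)
    then show ?thesis
      using der[OF U(2)] g[OF U(2)] has_derivative_at_withinI continuous_at_imp_continuous_at_within
      by metis
  qed
  then show ?thesis unfolding C1_on_def continuous_on_eq_continuous_within by blast
qed

lemma surface_has_derivative:
  assumes "x \<in> ball x0 1" "weight (S_hat I J V x) \<noteq> 0"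
  shows "(surface I J V has_derivative
    (\<lambda>h. fst h *\<^sub>R (projected_dir (S_hat I J V x) (window_sum I J V x0 N_spline' N_spline x)
            /\<^sub>R (weight (S_hat I J V x))\<^sup>2)
       + snd h *\<^sub>R (projected_dir (S_hat I J V x) (window_sum I J V x0 N_spline N_spline' x)
            /\<^sub>R (weight (S_hat I J V x))\<^sup>2))) (at x)"
  unfolding surface_def[abs_def]
  by (rule point_compose_has_derivative[OF S_hat_has_derivative[OF assms(1)] assms(2)])

lemma C1_on_surface:
  assumes "\<And>x. x \<in> D \<Longrightarrow> weight (S_hat I J V x) \<noteq> 0"
  shows "C1_on (surface I J V) D"
proof (rule C1_on_if_locally)
  fix x0 assume "x0 \<in> D"
  \<comment> \<open>Nonzero weight is assumed on \<open>D\<close> only; continuity extends it to an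
    open neighbourhood, also when \<open>x0\<close> is a boundary point of \<open>D\<close>.\<close>
  define U where "U = {x \<in> ball x0 1. weight (S_hat I J V x) \<noteq> 0}"
  have cont_S: "continuous_on (ball x0 1) (S_hat I J V)"
    by (intro continuous_at_imp_continuous_on ballI has_derivative_continuous[OF S_hat_has_derivative])
  have "open U"
  proof -
    have "U = ball x0 1 \<inter> (\<lambda>x. weight (S_hat I J V x)) -` (- {0})" by (auto simp: U_def)
    then show ?thesis
      using continuous_open_preimage[OF continuous_on_snd[OF cont_S], of "- {0}"] open_Compl[OF closed_singleton[of "0::real"]] by simp
  qed
  define f' where "f' x = partials_blinfun
      (projected_dir (S_hat I J V x) (window_sum I J V x0 N_spline' N_spline x) /\<^sub>R (weight (S_hat I J V x))\<^sup>2)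
      (projected_dir (S_hat I J V x) (window_sum I J V x0 N_spline N_spline' x) /\<^sub>R (weight (S_hat I J V x))\<^sup>2)" for x
  have "\<forall>x\<in>U. (surface I J V has_derivative blinfun_apply (f' x)) (at x)"
    unfolding f'_def blinfun_apply_partials by (intro ballI surface_has_derivative) (auto simp: U_def)
  moreover have "continuous_on U f'"
  proof -
    have "continuous_on U (S_hat I J V)"
      using cont_S by (rule continuous_on_subset) (auto simp: U_def)
    then show ?thesis
      unfolding f'_def projected_dir_def
      by (intro continuous_on_partials_blinfun continuous_intros continuous_on_window_sum)
        (auto simp: U_def)
  qed
  moreover have "x0 \<in> U" using assms[OF \<open>x0 \<in> D\<close>] by (simp add: U_def)
  ultimately show "\<exists>U f'. open U \<and> x0 \<in> U \<and>
    (\<forall>x\<in>U. (surface I J V has_derivative blinfun_apply (f' x)) (at x)) \<and> continuous_on U f'"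
    using \<open>open U\<close> by blast
qed

text \<open>All terms are nonnegative. Rounding both parameters to nearest integers gives a mesh
  vertex at distance at most 1/2 in each coordinate, where both B-spline factors are
  positive.\<close>

lemma S_hat_weight_pos:
  fixes V :: "int \<Rightarrow> int \<Rightarrow> hvec"
  assumes I: "index_interval I" and J: "index_interval J"
    and pos: "\<And>i j. i \<in> I \<Longrightarrow> j \<in> J \<Longrightarrow> 0 < weight (V i j)"
    and x: "x \<in> param_domain I J"
  shows "0 < weight (S_hat I J V x)"
proof -
  have near: "\<exists>i\<in>K. \<bar>u - real_of_int i\<bar> \<le> 1/2" if K: "index_interval K" "u \<in> param_interval K" for K u
  proof
    show "\<bar>u - real_of_int \<lfloor>u + 1/2\<rfloor>\<bar> \<le> 1/2" by linarith
    show "\<lfloor>u + 1/2\<rfloor> \<in> K"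
      using K(2) by (intro index_intervalI[OF K(1)]) (auto simp: param_interval_def, linarith+)
  qed
  obtain i j where ij: "i \<in> I" "\<bar>fst x - real_of_int i\<bar> \<le> 1/2" "j \<in> J" "\<bar>snd x - real_of_int j\<bar> \<le> 1/2"
    using near[OF I, of "fst x"] near[OF J, of "snd x"] x unfolding param_domain_def mem_Times_iff by blast
  have "weight (S_hat I J V x) = (\<Sum>(i, j)\<in>window x.
     N_spline (fst x - real_of_int i) * N_spline (snd x - real_of_int j) * weight (zero_ext I J V i j))"
    by (subst S_hat_eq_sum[of x x]) (simp_all add: snd_sum case_prod_unfold)
  also have "\<dots> > 0"
  proof (rule sum_pos2[of _ "(i, j)"])
    show "(i, j) \<in> window x" using ij by (auto simp: window_def)
    show "0 < (case (i, j) of (i, j) \<Rightarrow>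
      N_spline (fst x - real_of_int i) * N_spline (snd x - real_of_int j) * weight (zero_ext I J V i j))"
      using ij pos by (simp add: zero_ext_def N_spline_pos)
    show "0 \<le> (case p of (i, j) \<Rightarrow>
      N_spline (fst x - real_of_int i) * N_spline (snd x - real_of_int j) * weight (zero_ext I J V i j))" for p
      using pos by (auto simp: zero_ext_def N_spline_nonneg less_imp_le split: prod.split)
  qed (rule finite_window)
  finally show ?thesis .
qed

section \<open>Contact elements\<close>

text \<open>A condition on the pair: the set {e, f} would count as independent for e = f \<noteq>
  0.\<close>

definition indep2 :: "'a::real_vector \<Rightarrow> 'a \<Rightarrow> bool" where
  "indep2 e f \<longleftrightarrow> (\<forall>s t. s *\<^sub>R e + t *\<^sub>R f = 0 \<longrightarrow> s = 0 \<and> t = 0)"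

definition spanned_plane :: "'a::real_vector \<Rightarrow> 'a \<Rightarrow> 'a \<Rightarrow> 'a set" where
  "spanned_plane b e f = {b + s *\<^sub>R e + t *\<^sub>R f |s t. True}"

lemma spanned_planeI: "b + s *\<^sub>R e + t *\<^sub>R f \<in> spanned_plane b e f"
  unfolding spanned_plane_def by blast

lemma spanned_plane_scale:
  assumes "c \<noteq> 0"
  shows "spanned_plane b (c *\<^sub>R e) (c *\<^sub>R f) = spanned_plane b e f"
proof -
  have "\<exists>s' t'. b + s *\<^sub>R c *\<^sub>R e + t *\<^sub>R c *\<^sub>R f = b + s' *\<^sub>R e + t' *\<^sub>R f" for s t
    by (rule exI[of _ "s * c"], rule exI[of _ "t * c"]) simp
  moreover have "\<exists>s' t'. b + s *\<^sub>R e + t *\<^sub>R f = b + s' *\<^sub>R c *\<^sub>R e + t' *\<^sub>R c *\<^sub>R f" for s t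
    by (rule exI[of _ "s / c"], rule exI[of _ "t / c"]) (simp add: assms)
  ultimately show ?thesis unfolding spanned_plane_def by blast
qed

lemma indep2_scale:
  assumes "c \<noteq> 0"
  shows "indep2 (c *\<^sub>R e) (c *\<^sub>R f) \<longleftrightarrow> indep2 e f"
proof -
  have "s *\<^sub>R c *\<^sub>R e + t *\<^sub>R c *\<^sub>R f = c *\<^sub>R (s *\<^sub>R e + t *\<^sub>R f)" for s t
    by (simp add: scaleR_add_right mult.commute)
  then show ?thesis using assms by (simp add: indep2_def)
qed

text \<open>The points lie on two lines through \<open>b\<close>, two on each and on opposite sides
  of \<open>b\<close>. Hence the differences along each line are positive multiples of
  \<open>e\<close> and \<open>f\<close>, and a common line would make these parallel.\<close>

lemma not_collinear_cross_iff:
  fixes b e f :: "'a::real_vector"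
  assumes "0 < t0" "0 < t1" "0 < t2" "0 < t3"
  shows "\<not> collinear {b - t0 *\<^sub>R f, b + t1 *\<^sub>R e, b + t2 *\<^sub>R f, b - t3 *\<^sub>R e} \<longleftrightarrow> indep2 e f"
    (is "\<not> collinear ?E \<longleftrightarrow> _")
proof
  assume nc: "\<not> collinear ?E"
  show "indep2 e f"
    unfolding indep2_def
  proof (intro allI impI)
    fix s t assume 0: "s *\<^sub>R e + t *\<^sub>R f = 0"
    have multiples: "collinear ?E" if "e = p *\<^sub>R u" "f = q *\<^sub>R u" for p q u
      unfolding collinear_alt
      by (rule exI[of _ b], rule exI[of _ u])
        (auto simp: that intro: exI[of _ "t1 * p"] exI[of _ "t2 * q"] exI[of _ "- (t0 * q)"] exI[of _ "- (t3 * p)"])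
    have "t = 0"
    proof (rule ccontr)
      assume "t \<noteq> 0"
      have "t *\<^sub>R f = (- s) *\<^sub>R e" using 0 by (simp add: add_eq_0_iff)
      then have "f = (- s / t) *\<^sub>R e" using \<open>t \<noteq> 0\<close> unfolding eq_vector_fraction_iff by simp
      then show False using multiples[of 1 e "- s / t"] nc by simp
    qed
    moreover have "s = 0"
    proof (rule ccontr)
      assume "s \<noteq> 0"
      then have "e = 0 *\<^sub>R f" using 0 \<open>t = 0\<close> by simp
      then show False using multiples[of 0 f 1] nc by simp
    qed
    ultimately show "s = 0 \<and> t = 0" by simp
  qed
next
  assume ind: "indep2 e f"
  show "\<not> collinear ?E"
  proof
    assume "collinear ?E"
    then obtain u where u: "\<And>x y. x \<in> ?E \<Longrightarrow> y \<in> ?E \<Longrightarrow> \<exists>c. x - y = c *\<^sub>R u"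
      unfolding collinear_def by blast
    obtain c where c: "(b + t1 *\<^sub>R e) - (b - t3 *\<^sub>R e) = c *\<^sub>R u" using u[of "b + t1 *\<^sub>R e" "b - t3 *\<^sub>R e"] by auto
    obtain d where d: "(b + t2 *\<^sub>R f) - (b - t0 *\<^sub>R f) = d *\<^sub>R u" using u[of "b + t2 *\<^sub>R f" "b - t0 *\<^sub>R f"] by auto
    have c': "(t1 + t3) *\<^sub>R e = c *\<^sub>R u" using c by (simp add: algebra_simps)
    have d': "(t2 + t0) *\<^sub>R f = d *\<^sub>R u" using d by (simp add: algebra_simps)
    \<comment> \<open>Cross-multiplication eliminates the common direction \<open>u\<close>.\<close>
    have "(d * (t1 + t3)) *\<^sub>R e + (- c * (t2 + t0)) *\<^sub>R f = d *\<^sub>R (t1 + t3) *\<^sub>R e - c *\<^sub>R (t2 + t0) *\<^sub>R f"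
      by simp
    also have "\<dots> = 0" unfolding c' d' by simp
    finally have "d * (t1 + t3) = 0" using ind unfolding indep2_def by blast
    then have "d = 0" using assms by simp
    then have "0 *\<^sub>R e + (t2 + t0) *\<^sub>R f = 0" using d' by simp
    then have "t2 + t0 = 0" using ind unfolding indep2_def by blast
    then show False using assms by simp
  qed
qed

lemma affine_spanned_plane: "affine (spanned_plane b e f)"
  and aff_dim_spanned_plane: "indep2 e f \<Longrightarrow> aff_dim (spanned_plane b e f) = 2"
  for b e f :: "'a::euclidean_space"
proof -
  have eq: "spanned_plane b e f = (+) b ` span {e, f}"
    by (auto simp: spanned_plane_def span_insert span_singleton image_iff algebra_simps)
      (metis add.assoc add.commute diff_add_cancel)+
  show "affine (spanned_plane b e f)"
    unfolding eq by (metis affine_translation subspace_imp_affine subspace_span)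
  assume ind: "indep2 e f"
  have "e \<notin> span {f}"
  proof
    assume "e \<in> span {f}"
    then obtain k where "e = k *\<^sub>R f" by (auto simp: span_singleton)
    then have "1 *\<^sub>R e + (- k) *\<^sub>R f = 0" by simp
    then show False using ind unfolding indep2_def by (metis zero_neq_one)
  qed
  moreover have "f \<noteq> 0" using ind unfolding indep2_def by (metis add_0 scaleR_zero_left scaleR_zero_right zero_neq_one)
  ultimately have "independent {e, f}" "e \<noteq> f"
    by (auto simp: independent_insert span_base)
  then have "dim (span {e, f}) = 2" by (simp add: dim_eq_card_independent)
  then show "aff_dim (spanned_plane b e f) = 2"
    unfolding eq by (simp add: aff_dim_translation_eq aff_dim_subspace del: dim_span)
qed

text \<open>A non-collinear set inside a plane has affine dimension 2, so every plane containing it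
  equals its affine hull.\<close>

lemma the_plane_eq:
  fixes b e f :: "'a::euclidean_space"
  assumes "indep2 e f" "\<not> collinear E" "E \<subseteq> spanned_plane b e f"
  shows "(THE T. affine T \<and> aff_dim T = 2 \<and> E \<subseteq> T) = spanned_plane b e f"
proof -
  have hull: "affine hull E = T" if "affine T" "aff_dim T = 2" "E \<subseteq> T" for T
  proof (rule affine_dim_equal)
    show "affine hull E \<noteq> {}" using assms(2) by auto
    show "affine hull E \<subseteq> T" using that by (simp add: hull_minimal)
    have "aff_dim E \<le> 2" using aff_dim_subset[OF that(3)] that(2) by simp
    moreover have "\<not> aff_dim E \<le> 1" using assms(2) by (simp add: collinear_aff_dim)
    ultimately show "aff_dim (affine hull E) = aff_dim T" using that by simp
  qed (use that in auto)
  note plane = affine_spanned_plane[of b e f] aff_dim_spanned_plane[OF assms(1), of b] assms(3)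
  show ?thesis
  proof (rule the_equality)
    fix T assume "affine T \<and> aff_dim T = 2 \<and> E \<subseteq> T"
    then show "T = spanned_plane b e f" using hull[of T] hull[OF plane] by blast
  qed (use plane in blast)
qed

lemma unit_normal_spanned_plane:
  assumes "indep2 e f" "unit_normal (spanned_plane b e f) n" "unit_normal (spanned_plane b e f) n'"
  shows "n' = n \<or> n' = - n"
proof -
  have mem: "b \<in> spanned_plane b e f" "b + e \<in> spanned_plane b e f" "b + f \<in> spanned_plane b e f"
    using spanned_planeI[of b 0 e 0 f] spanned_planeI[of b 1 e 0 f] spanned_planeI[of b 0 e 1 f] by simp_all
  define p where "p = cross3 e f"
  have "p \<noteq> 0"
  proof
    assume "p = 0"
    then have "collinear {0, e, f}" by (simp add: p_def cross_eq_0)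
    then have "e = 0 \<or> f = 0 \<or> (\<exists>c. f = c *\<^sub>R e)" by (auto simp: collinear_lemma)
    then consider "1 *\<^sub>R e + 0 *\<^sub>R f = 0" | "0 *\<^sub>R e + 1 *\<^sub>R f = 0" | c where "c *\<^sub>R e + (- 1) *\<^sub>R f = 0" by auto
    then show False using assms(1) unfolding indep2_def by cases (metis zero_neq_one neg_equal_0_iff_equal)+
  qed
  have multiple: "\<exists>c. m = c *\<^sub>R p" if "unit_normal (spanned_plane b e f) m" for m
  proof -
    have "m \<bullet> e = 0" "m \<bullet> f = 0"
      using that mem unfolding unit_normal_def by (metis add_diff_cancel_left')+
    \<comment> \<open>The expansion of m \<times> (e \<times> f) has only the coefficients m
      \<bullet> f and m \<bullet> e, both zero.\<close>
    then have "cross3 m p = 0" by (simp add: p_def Lagrange)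
    then have "cross3 p m = 0" using cross_skew[of p m] by simp
    then have "collinear {0, p, m}" by (simp add: cross_eq_0)
    then show ?thesis using \<open>p \<noteq> 0\<close> by (auto simp: collinear_lemma intro: exI[of _ "0::real"])
  qed
  obtain c c' where c: "n = c *\<^sub>R p" "n' = c' *\<^sub>R p" using multiple assms by metis
  have "\<bar>c\<bar> * norm p = \<bar>c'\<bar> * norm p" using assms(2,3) c by (simp add: unit_normal_def)
  then have "\<bar>c\<bar> = \<bar>c'\<bar>" using \<open>p \<noteq> 0\<close> by simp
  then show ?thesis unfolding c by (auto simp: abs_eq_iff)
qed

section \<open>Homogeneous edge sums and the contact plane\<close>

text \<open>At the face center the spline has homogeneous value \<open>(q 0 + q 1 + q 2 + q 3) / 4\<close> and
  partial derivatives half the second arguments below, so these vectors are the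
  tangents of the projected surface up to a common positive factor.\<close>

definition tangent_u :: "(4 \<Rightarrow> hvec) \<Rightarrow> real ^ 3" where
  "tangent_u q = projected_dir (\<Sum>k\<in>UNIV. q k) (q 1 + q 2 - q 0 - q 3)"

definition tangent_v :: "(4 \<Rightarrow> hvec) \<Rightarrow> real ^ 3" where
  "tangent_v q = projected_dir (\<Sum>k\<in>UNIV. q k) (q 2 + q 3 - q 0 - q 1)"

lemma numerals_mod_4: "(4::4) = 0" "(5::4) = 1" "(- 1::4) = 3"
  by simp_all

lemma UNIV_4_eq: "(UNIV :: 4 set) = {0, 1, 2, 3}"
  using exhaust_4 numerals_mod_4(1) by auto

lemma sum_UNIV_4: "(\<Sum>k\<in>(UNIV::4 set). g k) = g 0 + g 1 + g 2 + g 3"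
  unfolding UNIV_4_eq by (simp add: add.assoc)

text \<open>In homogeneous coordinates a weighted mean is plain addition followed by central
  projection.\<close>

lemma edge_point_eq:
  assumes "\<And>k. 0 < weight (q k)"
  shows "edge_point q k = point (q k + q (k + 1))"
  using assms[of k] assms[of "k + 1"] by (simp add: edge_point_def point_def)

lemma contact_point_eq:
  assumes "\<And>k. 0 < weight (q k)"
  shows "contact_point q = point (\<Sum>k\<in>UNIV. q k)"
  using assms by (simp add: contact_point_def point_def fst_sum snd_sum less_imp_neq[symmetric])

text \<open>The finite displacement, not just its linearization, is parallel to
  \<open>projected_dir s d\<close>; the weight of \<open>s + d\<close> enters only through the
  scalar factor.\<close>

lemma point_add:
  assumes "weight s \<noteq> 0" "weight (s + d) \<noteq> 0"
  shows "point (s + d) = point s + (1 / (weight s * weight (s + d))) *\<^sub>R projected_dir s d"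
proof -
  have "(x + y) / (a + b) = x / a + (a * y - b * x) / (a * (a + b))"
    if "a \<noteq> 0" "a + b \<noteq> 0" for x y a b :: real
    using that by (simp add: divide_simps) algebra
  from this[of "weight s" "weight d"] show ?thesis
    using assms by (simp add: vec_eq_iff point_def projected_dir_def inverse_eq_divide)
qed

lemma point_scale: "c \<noteq> 0 \<Longrightarrow> point (c *\<^sub>R s) = point s"
  by (simp add: point_def)

lemma projected_dir_minus: "projected_dir s (- d) = - projected_dir s d"
  by (simp add: projected_dir_def)

text \<open>Opposite edge sums are \<open>(s + d) / 2\<close> and \<open>(s - d) / 2\<close> with \<open>s\<close> the sum of the four
  vertices, so the edge points lie on two lines through the contact point.\<close>

lemma range_edge_point:
  assumes pos: "\<And>k. 0 < weight (q k)"
  obtains t0 t1 t2 t3 where "0 < t0" "0 < t1" "0 < t2" "0 < t3"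
    "range (edge_point q) =
      {contact_point q - t0 *\<^sub>R tangent_v q, contact_point q + t1 *\<^sub>R tangent_u q,
       contact_point q + t2 *\<^sub>R tangent_v q, contact_point q - t3 *\<^sub>R tangent_u q}"
proof -
  define s where "s = (\<Sum>k\<in>UNIV. q k)"
  have s: "s = q 0 + q 1 + q 2 + q 3" by (simp add: s_def sum_UNIV_4)
  define x where "x = q 1 + q 2 - q 0 - q 3"
  define y where "y = q 2 + q 3 - q 0 - q 1"
  define r where "r d = 1 / (weight s * weight (s + d))" for d
  note w = pos[of 0] pos[of 1] pos[of 2] pos[of 3]
  have ws: "0 < weight s" using w by (simp add: s)
  have *: "edge_point q k = contact_point q + r d *\<^sub>R projected_dir s d \<and> 0 < r d"
    if "s + d = 2 *\<^sub>R (q k + q (k + 1))" for k d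
  proof -
    have wd: "0 < weight (s + d)" unfolding that using pos[of k] pos[of "k + 1"] by simp
    have "edge_point q k = point (s + d)" unfolding that by (simp add: point_scale edge_point_eq pos)
    also have "\<dots> = point s + r d *\<^sub>R projected_dir s d"
      unfolding r_def by (rule point_add) (use ws wd in auto)
    finally show ?thesis using ws wd by (simp add: contact_point_eq pos s_def r_def)
  qed
  have e: "edge_point q 0 = contact_point q + r (- y) *\<^sub>R projected_dir s (- y) \<and> 0 < r (- y)"
    "edge_point q 1 = contact_point q + r x *\<^sub>R projected_dir s x \<and> 0 < r x"
    "edge_point q 2 = contact_point q + r y *\<^sub>R projected_dir s y \<and> 0 < r y"
    "edge_point q 3 = contact_point q + r (- x) *\<^sub>R projected_dir s (- x) \<and> 0 < r (- x)"
    by (intro *; simp add: s x_def y_def scaleR_2 numerals_mod_4)+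
  have "tangent_u q = projected_dir s x" "tangent_v q = projected_dir s y"
    by (simp_all add: tangent_u_def tangent_v_def s_def x_def y_def)
  moreover have "range (edge_point q) = {edge_point q 0, edge_point q 1, edge_point q 2, edge_point q 3}"
    by (simp add: UNIV_4_eq)
  ultimately show thesis
    using that[of "r (- y)" "r x" "r y" "r (- x)"] e by (simp add: projected_dir_minus)
qed

lemma has_contact_element_iff:
  "has_contact_element q \<longleftrightarrow> (\<forall>k. 0 < weight (q k)) \<and> indep2 (tangent_u q) (tangent_v q)"
proof (cases "\<forall>k. 0 < weight (q k)")
  case True
  then obtain t0 t1 t2 t3 where "0 < t0" "0 < t1" "0 < t2" "0 < t3"
    "range (edge_point q) =
      {contact_point q - t0 *\<^sub>R tangent_v q, contact_point q + t1 *\<^sub>R tangent_u q,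
       contact_point q + t2 *\<^sub>R tangent_v q, contact_point q - t3 *\<^sub>R tangent_u q}"
    using range_edge_point[of q] by blast
  then show ?thesis by (simp add: has_contact_element_def not_collinear_cross_iff)
qed (auto simp: has_contact_element_def)

lemma contact_plane_eq:
  assumes q: "has_contact_element q"
  shows "contact_plane q = spanned_plane (contact_point q) (tangent_u q) (tangent_v q)"
proof -
  have pos: "0 < weight (q k)" for k using q by (simp add: has_contact_element_iff)
  obtain t0 t1 t2 t3 where "0 < t0" "0 < t1" "0 < t2" "0 < t3" and E: "range (edge_point q) =
      {contact_point q - t0 *\<^sub>R tangent_v q, contact_point q + t1 *\<^sub>R tangent_u q,
       contact_point q + t2 *\<^sub>R tangent_v q, contact_point q - t3 *\<^sub>R tangent_u q}"
    using range_edge_point[OF pos] .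
  have u: "contact_point q + t *\<^sub>R tangent_u q \<in> spanned_plane (contact_point q) (tangent_u q) (tangent_v q)"
    and v: "contact_point q + t *\<^sub>R tangent_v q \<in> spanned_plane (contact_point q) (tangent_u q) (tangent_v q)" for t
    using spanned_planeI[of "contact_point q" t "tangent_u q" 0 "tangent_v q"]
      spanned_planeI[of "contact_point q" 0 "tangent_u q" t "tangent_v q"] by simp_all
  show ?thesis
    unfolding contact_plane_def
  proof (rule the_plane_eq)
    show "indep2 (tangent_u q) (tangent_v q)" using q by (simp add: has_contact_element_iff)
    show "\<not> collinear (range (edge_point q))" using q by (simp add: has_contact_element_def)
    show "range (edge_point q) \<subseteq> spanned_plane (contact_point q) (tangent_u q) (tangent_v q)"
      unfolding E using u[of t1] u[of "- t3"] v[of t2] v[of "- t0"] by simp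
  qed
qed

lemma refined_face_values:
  "refined_face q 0 = (1 / 16) *\<^sub>R (9 *\<^sub>R q 0 + 3 *\<^sub>R q 1 + 3 *\<^sub>R q 3 + q 2)"
  "refined_face q 1 = (1 / 16) *\<^sub>R (9 *\<^sub>R q 1 + 3 *\<^sub>R q 2 + 3 *\<^sub>R q 0 + q 3)"
  "refined_face q 2 = (1 / 16) *\<^sub>R (9 *\<^sub>R q 2 + 3 *\<^sub>R q 3 + 3 *\<^sub>R q 1 + q 0)"
  "refined_face q 3 = (1 / 16) *\<^sub>R (9 *\<^sub>R q 3 + 3 *\<^sub>R q 0 + 3 *\<^sub>R q 2 + q 1)"
  by (simp_all add: refined_face_def numerals_mod_4 add_ac)

lemma sum_refined_face: "(\<Sum>k\<in>UNIV. refined_face q k) = (\<Sum>k\<in>UNIV. q k)" for q :: "4 \<Rightarrow> hvec"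
  by (simp add: sum_UNIV_4 refined_face_values prod_eq_iff vec_eq_iff algebra_simps)

lemma tangent_refined_face:
  "tangent_u (refined_face q) = (1 / 2) *\<^sub>R tangent_u q"
  "tangent_v (refined_face q) = (1 / 2) *\<^sub>R tangent_v q"
proof -
  have "refined_face q 1 + refined_face q 2 - refined_face q 0 - refined_face q 3
      = (1 / 2) *\<^sub>R (q 1 + q 2 - q 0 - q 3)"
    "refined_face q 2 + refined_face q 3 - refined_face q 0 - refined_face q 1
      = (1 / 2) *\<^sub>R (q 2 + q 3 - q 0 - q 1)"
    by (simp_all add: refined_face_values prod_eq_iff vec_eq_iff field_simps)
  moreover have "projected_dir s (c *\<^sub>R d) = c *\<^sub>R projected_dir s d" for s d c
    by (simp add: projected_dir_def scaleR_diff_right mult.commute)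
  ultimately show "tangent_u (refined_face q) = (1 / 2) *\<^sub>R tangent_u q"
    "tangent_v (refined_face q) = (1 / 2) *\<^sub>R tangent_v q"
    unfolding tangent_u_def tangent_v_def sum_refined_face by simp_all
qed

lemma refined_face_contact_element:
  assumes q: "has_contact_element q"
  shows "has_contact_element (refined_face q)"
    and "contact_point (refined_face q) = contact_point q"
    and "contact_plane (refined_face q) = contact_plane q"
proof -
  have pos: "0 < weight (q k)" for k using q by (simp add: has_contact_element_iff)
  have pos': "0 < weight (refined_face q k)" for k
    using pos by (simp add: refined_face_def add_pos_pos)
  show *: "has_contact_element (refined_face q)"
    using q pos' by (simp add: has_contact_element_iff tangent_refined_face indep2_scale)
  show point: "contact_point (refined_face q) = contact_point q"
    by (simp add: contact_point_eq pos pos' sum_refined_face)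
  show "contact_plane (refined_face q) = contact_plane q"
    unfolding contact_plane_eq[OF q] contact_plane_eq[OF *] point tangent_refined_face
    by (simp add: spanned_plane_scale)
qed

lemma unit_normal_contact_plane:
  assumes "has_contact_element q" "unit_normal (contact_plane q) n" "unit_normal (contact_plane q) n'"
  shows "n' = n \<or> n' = - n"
  by (rule unit_normal_spanned_plane[of "tangent_u q" "tangent_v q" "contact_point q"])
    (use assms in \<open>simp_all add: contact_plane_eq has_contact_element_iff[of q]\<close>)

section \<open>The spline surface at the face centers\<close>

lemma center_in_param_interval:
  assumes "i \<in> I" "i + 1 \<in> I"
  shows "real_of_int i + 1 / 2 \<in> param_interval I"
proof -
  have "real_of_int (Inf I) \<le> real_of_int i" if "bdd_below I"
    unfolding of_int_le_iff using that assms by (intro cInf_lower)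
  moreover have "real_of_int (i + 1) \<le> real_of_int (Sup I)" if "bdd_above I"
    unfolding of_int_le_iff using that assms by (intro cSup_upper)
  ultimately show ?thesis by (auto simp: param_interval_def)
qed

lemma Inf_plus_2_le_Sup:
  assumes "index_interval I" "bdd_below I" "bdd_above I"
  shows "Inf I + 2 \<le> Sup I"
proof -
  have sub: "I \<subseteq> {Inf I..Sup I}" using assms by (auto intro: cInf_lower cSup_upper)
  then have "finite I" by (rule finite_subset) simp
  then have "3 \<le> card I" using assms(1) by (simp add: index_interval_def)
  also have "card I \<le> card {Inf I..Sup I}" using sub by (rule card_mono[rotated]) simp
  finally show ?thesis by simp
qed

lemma param_interval_nondegenerate:
  assumes I: "index_interval I" and u: "u \<in> param_interval I" and "0 < e"
  shows "\<exists>d. 0 < \<bar>d\<bar> \<and> \<bar>d\<bar> < e \<and> u + d \<in> param_interval I"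
proof -
  \<comment> \<open>Three indices give the interval length at least 1, so a step of at most 1/2 fits
    upwards or else downwards.\<close>
  define d where "d = min (e / 2) (1 / 2)"
  have d: "0 < d" "d < e" "d \<le> 1 / 2" using \<open>0 < e\<close> by (auto simp: d_def)
  show ?thesis
  proof (cases "bdd_above I \<and> real_of_int (Sup I) - 1 / 2 < u + d")
    case True
    have "real_of_int (Inf I) + 1 / 2 \<le> u - d" if "bdd_below I"
    proof -
      have "real_of_int (Inf I + 2) \<le> real_of_int (Sup I)"
        unfolding of_int_le_iff using I that True by (intro Inf_plus_2_le_Sup) auto
      then show ?thesis using True d by simp
    qed
    then have "u + (- d) \<in> param_interval I" using u d by (auto simp: param_interval_def)
    then show ?thesis using d by (intro exI[of _ "- d"]) auto
  next
    case False
    then have "u + d \<in> param_interval I" using u d by (auto simp: param_interval_def)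
    then show ?thesis using d by (intro exI[of _ d]) auto
  qed
qed

text \<open>\<open>frechet_derivative\<close> is a choice; it is pinned down since the domain can be
  approached along both coordinate directions from each of its points, even at corners.\<close>

lemma frechet_derivative_param_domain:
  assumes "index_interval I" "index_interval J" "c \<in> param_domain I J"
    and "(f has_derivative f') (at c within param_domain I J)"
  shows "frechet_derivative f (at c within param_domain I J) = f'"
proof (rule frechet_derivative_unique_within)
  show "(f has_derivative frechet_derivative f (at c within param_domain I J)) (at c within param_domain I J)"
    using assms(4) differentiableI frechet_derivative_works by blast
  fix k :: "real \<times> real" and e :: real
  assume "k \<in> Basis" "0 < e"
  obtain u v where c: "c = (u, v)" "u \<in> param_interval I" "v \<in> param_interval J"
    using assms(3) by (auto simp: param_domain_def)
  have "k = (1, 0) \<or> k = (0, 1)" using \<open>k \<in> Basis\<close> by (auto simp: Basis_prod_def)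
  then show "\<exists>d. 0 < \<bar>d\<bar> \<and> \<bar>d\<bar> < e \<and> c + d *\<^sub>R k \<in> param_domain I J"
    using param_interval_nondegenerate[OF assms(1) c(2) \<open>0 < e\<close>]
      param_interval_nondegenerate[OF assms(2) c(3) \<open>0 < e\<close>] c by (auto simp: param_domain_def)
qed fact

lemma N_spline_at_half: "N_spline (1 / 2) = 1 / 2" "N_spline (- (1 / 2)) = 1 / 2"
  "N_spline' (1 / 2) = - 1" "N_spline' (- (1 / 2)) = 1"
  by (simp_all add: N_spline_explicit N_spline'_def power2_eq_square)

lemma N_spline_support: "3 / 2 \<le> \<bar>x\<bar> \<Longrightarrow> N_spline x = 0" "3 / 2 \<le> \<bar>x\<bar> \<Longrightarrow> N_spline' x = 0"
  by (auto simp: N_spline_explicit N_spline'_def max_def abs_if split: if_splits)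

text \<open>The center is at distance 1/2 from the two indices of the face in each coordinate and at
  least 3/2 from all others, so exactly the four corners survive.\<close>

lemma window_sum_face_center:
  fixes V :: "int \<Rightarrow> int \<Rightarrow> 'a::real_vector"
  assumes f: "\<And>x. 3 / 2 \<le> \<bar>x\<bar> \<Longrightarrow> f x = 0" and g: "\<And>x. 3 / 2 \<le> \<bar>x\<bar> \<Longrightarrow> g x = 0"
    and ij: "(i, j) \<in> faces I J"
  defines "c \<equiv> face_center i j" and "q \<equiv> face V i j"
  shows "window_sum I J V c f g c = (f (1 / 2) * g (1 / 2)) *\<^sub>R q 0 + (f (- (1 / 2)) * g (1 / 2)) *\<^sub>R q 1
    + (f (- (1 / 2)) * g (- (1 / 2))) *\<^sub>R q 2 + (f (1 / 2) * g (- (1 / 2))) *\<^sub>R q 3"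
proof -
  have far: "3 / 2 \<le> \<bar>real_of_int k + 1 / 2 - real_of_int z\<bar>" if "z \<notin> {k, k + 1}" for k z
  proof -
    have "z \<le> k - 1 \<or> z \<ge> k + 2" using that by auto
    then have "real_of_int z \<le> real_of_int k - 1 \<or> real_of_int z \<ge> real_of_int k + 2" by linarith
    then show ?thesis by linarith
  qed
  have "window_sum I J V c f g c = (\<Sum>(i', j')\<in>{i, i + 1} \<times> {j, j + 1}.
     (f (fst c - real_of_int i') * g (snd c - real_of_int j')) *\<^sub>R zero_ext I J V i' j')"
    unfolding window_sum_def
  proof (rule sum.mono_neutral_right[OF finite_window])
    show "{i, i + 1} \<times> {j, j + 1} \<subseteq> window c" by (auto simp: window_def c_def face_center_def)
    have "f (fst c - real_of_int i') * g (snd c - real_of_int j') = 0"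
      if "i' \<notin> {i, i + 1} \<or> j' \<notin> {j, j + 1}" for i' j'
      using that far[of i' i] far[of j' j] f g unfolding c_def face_center_def fst_conv snd_conv
      by (metis mult_eq_0_iff)
    then show "\<forall>p\<in>window c - {i, i + 1} \<times> {j, j + 1}. (case p of (i', j') \<Rightarrow>
       (f (fst c - real_of_int i') * g (snd c - real_of_int j')) *\<^sub>R zero_ext I J V i' j') = 0"
      by fastforce
  qed
  also have "\<dots> = (\<Sum>i'\<in>{i, i + 1}. \<Sum>j'\<in>{j, j + 1}.
     (f (fst c - real_of_int i') * g (snd c - real_of_int j')) *\<^sub>R zero_ext I J V i' j')"
    by (rule sum.cartesian_product[symmetric])
  also have "\<dots> = (f (1 / 2) * g (1 / 2)) *\<^sub>R q 0 + (f (- (1 / 2)) * g (1 / 2)) *\<^sub>R q 1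
    + (f (- (1 / 2)) * g (- (1 / 2))) *\<^sub>R q 2 + (f (1 / 2) * g (- (1 / 2))) *\<^sub>R q 3"
    using ij by (simp add: c_def q_def face_center_def face_def zero_ext_def faces_def add_ac)
  finally show ?thesis .
qed

lemma range_eq_spanned_plane:
  "range (\<lambda>h :: real \<times> real. b + (fst h *\<^sub>R e + snd h *\<^sub>R f)) = spanned_plane b e f"
proof (intro equalityI subsetI)
  fix x assume "x \<in> spanned_plane b e f"
  then obtain s t where "x = b + s *\<^sub>R e + t *\<^sub>R f" unfolding spanned_plane_def by blast
  then show "x \<in> range (\<lambda>h :: real \<times> real. b + (fst h *\<^sub>R e + snd h *\<^sub>R f))"
    by (intro range_eqI[of _ _ "(s, t)"]) (simp add: add.assoc)
qed (auto simp: spanned_plane_def add.assoc)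

lemma surface_face_center:
  fixes V :: "int \<Rightarrow> int \<Rightarrow> hvec"
  assumes I: "index_interval I" and J: "index_interval J" and ij: "(i, j) \<in> faces I J"
  defines "c \<equiv> face_center i j" and "q \<equiv> face V i j" and "D \<equiv> param_domain I J"
  assumes q: "has_contact_element q"
  shows "c \<in> D" and "surface I J V c = contact_point q"
    and "regular_at (surface I J V) D c" and "tangent_plane (surface I J V) D c = contact_plane q"
proof -
  show cD: "c \<in> D"
    using ij by (auto simp: c_def D_def param_domain_def face_center_def faces_def intro: center_in_param_interval)
  define s where "s = (\<Sum>k\<in>UNIV. q k)"
  have pos: "0 < weight (q k)" for k using q by (simp add: has_contact_element_iff)
  have S: "S_hat I J V c = (1 / 4) *\<^sub>R s"
    using window_sum_face_center[of N_spline N_spline i j I J V, OF N_spline_support(1) N_spline_support(1) ij]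
    by (simp add: S_hat_eq_window_sum[of c c] N_spline_at_half s_def sum_UNIV_4 scaleR_add_right
        flip: c_def q_def)
  have Su: "window_sum I J V c N_spline' N_spline c = (1 / 2) *\<^sub>R (q 1 + q 2 - q 0 - q 3)"
    using window_sum_face_center[of N_spline' N_spline i j I J V, OF N_spline_support(2) N_spline_support(1) ij]
    by (simp add: N_spline_at_half algebra_simps flip: c_def q_def)
  have Sv: "window_sum I J V c N_spline N_spline' c = (1 / 2) *\<^sub>R (q 2 + q 3 - q 0 - q 1)"
    using window_sum_face_center[of N_spline N_spline' i j I J V, OF N_spline_support(1) N_spline_support(2) ij]
    by (simp add: N_spline_at_half algebra_simps flip: c_def q_def)
  have "0 < weight s" using pos by (simp add: s_def sum_UNIV_4 add_pos_pos)
  \<comment> \<open>\<open>projected_dir\<close> is linear in each argument: the factors 1/4 and 1/2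
    combine to 1/8, and the quotient rule divides by the squared weight of the spline value.\<close>
  define r where "r = 1 / (8 * (weight s / 4)\<^sup>2)"
  have r: "r \<noteq> 0" using \<open>0 < weight s\<close> by (simp add: r_def)
  have dir: "projected_dir ((1 / 4) *\<^sub>R s) ((1 / 2) *\<^sub>R d) /\<^sub>R (weight ((1 / 4) *\<^sub>R s))\<^sup>2
      = r *\<^sub>R projected_dir s d" for d
    by (simp add: projected_dir_def r_def scaleR_diff_right inverse_eq_divide mult.commute)
  have "(surface I J V has_derivative (\<lambda>h. fst h *\<^sub>R (r *\<^sub>R tangent_u q) + snd h *\<^sub>R (r *\<^sub>R tangent_v q))) (at c)"
    using surface_has_derivative[of c c I J V] \<open>0 < weight s\<close>
    unfolding S Su Sv dir tangent_u_def tangent_v_def s_def[symmetric] by simp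
  then have der: "(surface I J V has_derivative (\<lambda>h. fst h *\<^sub>R (r *\<^sub>R tangent_u q) + snd h *\<^sub>R (r *\<^sub>R tangent_v q)))
      (at c within D)"
    by (rule has_derivative_at_withinI)
  have frechet: "frechet_derivative (surface I J V) (at c within D)
      = (\<lambda>h. fst h *\<^sub>R (r *\<^sub>R tangent_u q) + snd h *\<^sub>R (r *\<^sub>R tangent_v q))"
    unfolding D_def by (rule frechet_derivative_param_domain[OF I J cD[unfolded D_def] der[unfolded D_def]])
  show point: "surface I J V c = contact_point q"
    unfolding surface_def S by (simp add: point_scale contact_point_eq pos s_def)
  have ind: "indep2 (r *\<^sub>R tangent_u q) (r *\<^sub>R tangent_v q)"
    using q r by (simp add: has_contact_element_iff indep2_scale)
  show "regular_at (surface I J V) D c"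
    unfolding regular_at_def frechet
  proof
    show "surface I J V differentiable at c within D" using der by (rule differentiableI)
    show "inj (\<lambda>h :: real \<times> real. fst h *\<^sub>R (r *\<^sub>R tangent_u q) + snd h *\<^sub>R (r *\<^sub>R tangent_v q))"
    proof (rule injI)
      fix h k :: "real \<times> real"
      assume "fst h *\<^sub>R (r *\<^sub>R tangent_u q) + snd h *\<^sub>R (r *\<^sub>R tangent_v q)
        = fst k *\<^sub>R (r *\<^sub>R tangent_u q) + snd k *\<^sub>R (r *\<^sub>R tangent_v q)"
      then have "(fst h - fst k) *\<^sub>R (r *\<^sub>R tangent_u q) + (snd h - snd k) *\<^sub>R (r *\<^sub>R tangent_v q) = 0"
        unfolding scaleR_diff_left by (simp add: algebra_simps)
      then have "fst h - fst k = 0 \<and> snd h - snd k = 0" using ind unfolding indep2_def by blast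
      then show "h = k" by (simp add: prod_eq_iff)
    qed
  qed
  have "tangent_plane (surface I J V) D c = spanned_plane (contact_point q) (r *\<^sub>R tangent_u q) (r *\<^sub>R tangent_v q)"
    unfolding tangent_plane_def frechet point by (rule range_eq_spanned_plane)
  then show "tangent_plane (surface I J V) D c = contact_plane q"
    using q r by (simp add: spanned_plane_scale contact_plane_eq)
qed

theorem proposition2p3:
  fixes I J :: "int set"
    and v :: "int \<Rightarrow> int \<Rightarrow> real ^ 3"
    and w :: "int \<Rightarrow> int \<Rightarrow> real"
  assumes "index_interval I" and "index_interval J"
    and "\<And>i j. i \<in> I \<Longrightarrow> j \<in> J \<Longrightarrow> 0 < w i j"
    and "\<And>i j. (i, j) \<in> faces I J \<Longrightarrow> has_contact_element (face (homog v w) i j)"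
  shows
    "(\<forall>(i, j) \<in> faces I J.
        let f = face (homog v w) i j; f' = refined_face f in
          has_contact_element f' \<and>
          contact_point f' = contact_point f \<and>
          contact_plane f' = contact_plane f \<and>
          (\<forall>n n'. unit_normal (contact_plane f) n \<and> unit_normal (contact_plane f') n'
             \<longrightarrow> n' = n \<or> n' = - n)) \<and>
     (locally_uniform_limit (param_domain I J)
        (refined_interpolant I J (homog v w)) (S_hat I J (homog v w)) \<and>
      (\<forall>x \<in> param_domain I J. 0 < weight (S_hat I J (homog v w) x)) \<and>
      C1_on (surface I J (homog v w)) (param_domain I J)) \<and>
     (\<forall>(i, j) \<in> faces I J.
        let f = face (homog v w) i j; s = surface I J (homog v w);
            D = param_domain I J; c = face_center i j in
          c \<in> D \<and>
          s c = contact_point f \<and>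
          regular_at s D c \<and>
          tangent_plane s D c = contact_plane f \<and>
          (\<forall>n n'. unit_normal (contact_plane f) n \<and> unit_normal (tangent_plane s D c) n'
             \<longrightarrow> n' = n \<or> n' = - n))"
proof -
  note contact = assms(4)
  have pos: "0 < weight (S_hat I J (homog v w) x)" if "x \<in> param_domain I J" for x
    by (rule S_hat_weight_pos[OF assms(1,2) _ that]) (simp add: homog_def assms(3))
  have C1: "C1_on (surface I J (homog v w)) (param_domain I J)"
    by (rule C1_on_surface) (use pos in force)
  \<comment> \<open>The refined plane and the tangent plane both equal the contact plane, so this
    one fact about a single plane serves both claims about normals.\<close>
  have normal: "n' = n \<or> n' = - n"
    if "(i, j) \<in> faces I J" "unit_normal (contact_plane (face (homog v w) i j)) n"
      "unit_normal (contact_plane (face (homog v w) i j)) n'" for i j n n'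
    using unit_normal_contact_plane[OF contact[OF that(1)] that(2,3)] .
  have "has_contact_element (refined_face (face (homog v w) i j)) \<and>
      contact_point (refined_face (face (homog v w) i j)) = contact_point (face (homog v w) i j) \<and>
      contact_plane (refined_face (face (homog v w) i j)) = contact_plane (face (homog v w) i j) \<and>
      (\<forall>n n'. unit_normal (contact_plane (face (homog v w) i j)) n
         \<and> unit_normal (contact_plane (refined_face (face (homog v w) i j))) n' \<longrightarrow> n' = n \<or> n' = - n)"
    if "(i, j) \<in> faces I J" for i j
    unfolding refined_face_contact_element(2,3)[OF contact[OF that]]
    using refined_face_contact_element(1)[OF contact[OF that]] normal[OF that] by blast
  moreover have "face_center i j \<in> param_domain I J \<and>
      surface I J (homog v w) (face_center i j) = contact_point (face (homog v w) i j) \<and>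
      regular_at (surface I J (homog v w)) (param_domain I J) (face_center i j) \<and>
      tangent_plane (surface I J (homog v w)) (param_domain I J) (face_center i j)
        = contact_plane (face (homog v w) i j) \<and>
      (\<forall>n n'. unit_normal (contact_plane (face (homog v w) i j)) n
         \<and> unit_normal (tangent_plane (surface I J (homog v w)) (param_domain I J) (face_center i j)) n'
         \<longrightarrow> n' = n \<or> n' = - n)"
    if "(i, j) \<in> faces I J" for i j
    unfolding surface_face_center(4)[OF assms(1,2) that contact[OF that]]
    using surface_face_center(1-3)[OF assms(1,2) that contact[OF that]] normal[OF that] by blast
  ultimately show ?thesis
    unfolding Let_def
    using pos C1 locally_uniform_limit_refined_interpolant[OF assms(1,2), of "homog v w"] by blast
qed

end
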